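(* Let $V=\mathbb{C}_q(n|n)$. For every $k\ge2$, the $\mathfrak{U}_q\mathfrak{p}_n$-module $V^{\otimes k}$ is not completely reducible.
   Context: Let $n$ be a positive integer. Indices $i,j,k,l,a,b$ of generators and matrices range over $\{\pm1,\dots,\pm n\}$; $p(i)=0$ if $i>0$ and $p(i)=1$ if $i<0$; $\delta_{ij}$ is the Kronecker delta and $\delta_{\mathcal{C}}$ is $1$ if the condition $\mathcal{C}$ holds and $0$ otherwise; $\theta(i,j,k)=\operatorname{sgn}(\operatorname{sgn}(i)+\operatorname{sgn}(j)+\operatorname{sgn}(k))$. $\mathfrak{U}_q\mathfrak{p}_n$ is the unital associative superalgebra over $\mathbb{C}(q)$ generated by elements $t_{ij}$ (of parity $p(i)+p(j)$) and $t_{ii}^{-1}$ with $1\le|i|\le|j|\le n$, such that $t_{ii}^{-1}$ is inverse to $t_{ii}$, $t_{ii}=t_{-i,-i}$, $t_{-i,i}=0$ if $i>0$, $t_{ij}=0$ if $|i|>|j|$, and for all $i,j,k,l$: $$\begin{aligned}&(-1)^{(p(i)+p(j))(p(k)+p(l))}t_{ij}t_{kl}-t_{kl}t_{ij}+\theta(i,j,k)(\delta_{|j|<|l|}-\delta_{|k|<|i|})(q-q^{-1})t_{il}t_{kj}\\&+(-1)^{(p(i)+p(j))(p(k)+p(l))}\big(\delta_{j>0}(q-1)+\delta_{j<0}(q^{-1}-1)\big)(\delta_{jl}+\delta_{j,-l})t_{ij}t_{kl}\\&-\big(\delta_{i>0}(q-1)+\delta_{i<0}(q^{-1}-1)\big)(\delta_{ik}+\delta_{i,-k})t_{kl}t_{ij}\\&+\theta(i,j,k)\delta_{j>0}\delta_{j,-l}(q-q^{-1})t_{i,-j}t_{k,-l}-(-1)^{p(j)}\delta_{i<0}\delta_{i,-k}(q-q^{-1})t_{-k,l}t_{-i,j}\\&+(-1)^{p(j)(p(i)+1)}(q-q^{-1})\sum_{a}\big((-1)^{p(i)p(a)}\theta(i,j,k)\delta_{j,-l}\delta_{|a|<|l|}t_{i,-a}t_{ka}+(-1)^{p(-j)p(a)}\delta_{i,-k}\delta_{|k|<|a|}t_{al}t_{-a,j}\big)=0.\end{aligned}$$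 The comultiplication is $\Delta(t_{ij})=\sum_k(-1)^{(p(i)+p(k))(p(k)+p(j))}t_{ik}\otimes t_{kj}$. $V=\mathbb{C}_q(n|n)$ is the $\mathbb{C}(q)$-superspace with basis $u_a$, $a\in\{\pm1,\dots,\pm n\}$, $u_a$ of parity $p(a)$. $E_{ij}$ is the elementary matrix ($E_{ij}u_a=\delta_{ja}u_i$), and $\mathsf{E}_{ij}=E_{ij}-(-1)^{p(i)(p(j)+1)}E_{-j,-i}$. The action on $V$ is $t_{ii}u_a=\sum_bq^{\delta_{bi}(1-2p(i))+\delta_{b,-i}(2p(i)-1)}E_{bb}u_a$; $t_{i,-i}u_a=(q-q^{-1})\delta_{i>0}E_{-i,i}u_a$; $t_{ij}u_a=(q-q^{-1})(-1)^{p(i)}\mathsf{E}_{ji}u_a$ if $|i|<|j|$. It extends to $V^{\otimes k}$ via iterated $\Delta$, with the sign rule $(x\otimes y)(v\otimes w)=(-1)^{|y||v|}xv\otimes yw$. *)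

theory Defs
  imports "HOL-Algebra.QuotRing" "HOL-Library.Poly_Mapping"
    "HOL-Computational_Algebra.Polynomial" "HOL-Computational_Algebra.Fraction_Field"
begin

text \<open>
  Lists under concatenation form the free monoid, so \<open>'a list \<Rightarrow>\<^sub>0 'k\<close> with the product of
  \<^theory>\<open>HOL-Library.Poly_Mapping\<close> is the free associative algebra over \<open>'k\<close> on \<open>'a\<close>, that is, the
  tensor algebra of the vector space with basis \<open>'a\<close>.  It is used twice: for the free algebra on the
  generators \<open>t\<^sub>i\<^sub>j\<close>, \<open>t\<^sub>i\<^sub>i\<close> inverse, and for the tensor algebra of \<open>V\<close>, where the basis vector
  \<open>u\<^sub>a \<otimes> u\<^sub>b \<otimes> \<dots>\<close> is \<open>Poly_Mapping.single [a, b, \<dots>] 1\<close> and \<open>\<otimes>\<close> is \<open>*\<close>.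
\<close>

instantiation list :: (type) monoid_add
begin
definition zero_list :: "'a list" where "0 = []"
definition plus_list :: "'a list \<Rightarrow> 'a list \<Rightarrow> 'a list" where "xs + ys = xs @ ys"
instance by standard (auto simp: zero_list_def plus_list_def)
end

definition scl :: "'k \<Rightarrow> ('a \<Rightarrow>\<^sub>0 'k) \<Rightarrow> ('a \<Rightarrow>\<^sub>0 'k::field)" (infixr "\<cdot>" 75) where
  "c \<cdot> x = Poly_Mapping.map ((*) c) x"

lemma lookup_scl [simp]: "Poly_Mapping.lookup (c \<cdot> x) w = c * Poly_Mapping.lookup x w"
  by (simp add: scl_def Poly_Mapping.map.rep_eq when_def)

global_interpretation scl: vector_space "scl :: 'k \<Rightarrow> ('a \<Rightarrow>\<^sub>0 'k) \<Rightarrow> ('a \<Rightarrow>\<^sub>0 'k::field)"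
  by standard (auto intro!: poly_mapping_eqI simp: lookup_add algebra_simps)

definition lin_ext :: "('a \<Rightarrow> ('b \<Rightarrow>\<^sub>0 'k)) \<Rightarrow> ('a \<Rightarrow>\<^sub>0 'k) \<Rightarrow> ('b \<Rightarrow>\<^sub>0 'k::field)" where
  "lin_ext f x = (\<Sum>w\<in>Poly_Mapping.keys x. Poly_Mapping.lookup x w \<cdot> f w)"


section \<open>The algebra\<close>

type_synonym Cq = "complex poly fract"

definition q :: Cq where "q = Fract [:0, 1:] 1"

abbreviation qd :: Cq where "qd \<equiv> q - inverse q"

definition idx :: "nat \<Rightarrow> int set" where "idx n = {i. 1 \<le> \<bar>i\<bar> \<and> \<bar>i\<bar> \<le> int n}"

definition par :: "int \<Rightarrow> nat" where "par i = (if i > 0 then 0 else 1)"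

definition theta :: "int \<Rightarrow> int \<Rightarrow> int \<Rightarrow> Cq" where
  "theta i j k = of_int (sgn (sgn i + sgn j + sgn k))"

datatype gen = T int int | Tinv int

definition gens :: "nat \<Rightarrow> gen set" where
  "gens n = {T i j | i j. i \<in> idx n \<and> j \<in> idx n \<and> \<bar>i\<bar> \<le> \<bar>j\<bar>} \<union> {Tinv i | i. i \<in> idx n}"

definition free_alg :: "nat \<Rightarrow> (gen list \<Rightarrow>\<^sub>0 Cq) ring" where
  "free_alg n = \<lparr>carrier = {x. Poly_Mapping.keys x \<subseteq> lists (gens n)}, monoid.mult = (*), one = 1,
     zero = 0, add = (+)\<rparr>"

lemma ring_free_alg: "ring (free_alg n)"
proof (rule ringI)
  show "abelian_group (free_alg n)"
  proof (rule abelian_groupI)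
    fix x assume "x \<in> carrier (free_alg n)"
    then show "\<exists>y\<in>carrier (free_alg n). y \<oplus>\<^bsub>free_alg n\<^esub> x = \<zero>\<^bsub>free_alg n\<^esub>"
      by (intro bexI[of _ "- x"]) (auto simp: free_alg_def)
  qed (use Poly_Mapping.keys_add in \<open>fastforce simp: free_alg_def add_ac\<close>)+
  show "Group.monoid (free_alg n)"
  proof (rule monoidI)
    fix x y assume "x \<in> carrier (free_alg n)" "y \<in> carrier (free_alg n)"
    then show "x \<otimes>\<^bsub>free_alg n\<^esub> y \<in> carrier (free_alg n)"
      using Poly_Mapping.keys_mult[of x y] by (fastforce simp: free_alg_def plus_list_def)
  qed (auto simp: free_alg_def mult.assoc zero_list_def)
qed (auto simp: free_alg_def distrib_left distrib_right)

definition gen_t :: "int \<Rightarrow> int \<Rightarrow> (gen list \<Rightarrow>\<^sub>0 Cq)" where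
  "gen_t i j = (if \<bar>i\<bar> \<le> \<bar>j\<bar> then Poly_Mapping.single [T i j] 1 else 0)"

definition gen_tinv :: "int \<Rightarrow> (gen list \<Rightarrow>\<^sub>0 Cq)" where
  "gen_tinv i = Poly_Mapping.single [Tinv i] 1"

definition qm :: "int \<Rightarrow> Cq" where
  "qm i = of_bool (i > 0) * (q - 1) + of_bool (i < 0) * (inverse q - 1)"

definition relator :: "nat \<Rightarrow> int \<Rightarrow> int \<Rightarrow> int \<Rightarrow> int \<Rightarrow> (gen list \<Rightarrow>\<^sub>0 Cq)" where
  "relator n i j k l =
     (-1) ^ ((par i + par j) * (par k + par l)) \<cdot> (gen_t i j * gen_t k l) - gen_t k l * gen_t i j
     + (theta i j k * (of_bool (\<bar>j\<bar> < \<bar>l\<bar>) - of_bool (\<bar>k\<bar> < \<bar>i\<bar>)) * qd) \<cdot> (gen_t i l * gen_t k j)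
     + ((-1) ^ ((par i + par j) * (par k + par l)) * qm j * (of_bool (j = l) + of_bool (j = - l)))
         \<cdot> (gen_t i j * gen_t k l)
     - (qm i * (of_bool (i = k) + of_bool (i = - k))) \<cdot> (gen_t k l * gen_t i j)
     + (theta i j k * of_bool (j > 0) * of_bool (j = - l) * qd) \<cdot> (gen_t i (- j) * gen_t k (- l))
     - ((-1) ^ par j * of_bool (i < 0) * of_bool (i = - k) * qd) \<cdot> (gen_t (- k) l * gen_t (- i) j)
     + ((-1) ^ (par j * (par i + 1)) * qd) \<cdot> (\<Sum>a\<in>idx n.
         ((-1) ^ (par i * par a) * theta i j k * of_bool (j = - l) * of_bool (\<bar>a\<bar> < \<bar>l\<bar>))
           \<cdot> (gen_t i (- a) * gen_t k a)
         + ((-1) ^ (par (- j) * par a) * of_bool (i = - k) * of_bool (\<bar>k\<bar> < \<bar>a\<bar>))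
           \<cdot> (gen_t a l * gen_t (- a) j))"

definition relators :: "nat \<Rightarrow> (gen list \<Rightarrow>\<^sub>0 Cq) set" where
  "relators n =
     {gen_t i i * gen_tinv i - 1 | i. i \<in> idx n} \<union> {gen_tinv i * gen_t i i - 1 | i. i \<in> idx n}
     \<union> {gen_t i i - gen_t (- i) (- i) | i. i \<in> idx n} \<union> {gen_t (- i) i | i. i \<in> idx n \<and> i > 0}
     \<union> {relator n i j k l | i j k l. i \<in> idx n \<and> j \<in> idx n \<and> k \<in> idx n \<and> l \<in> idx n}"

lemma relators_subset: "relators n \<subseteq> carrier (free_alg n)"
proof -
  interpret R: ring "free_alg n" by (rule ring_free_alg)
  have add: "x + y \<in> carrier (free_alg n)" and mult: "x * y \<in> carrier (free_alg n)"
    if "x \<in> carrier (free_alg n)" "y \<in> carrier (free_alg n)" for x y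
    using R.a_closed[OF that] R.m_closed[OF that] by (simp_all add: free_alg_def)
  have minus: "x - y \<in> carrier (free_alg n)"
    if "x \<in> carrier (free_alg n)" "y \<in> carrier (free_alg n)" for x y
    using add[OF that(1), of "- y"] that(2) by (simp add: free_alg_def)
  have scl: "c \<cdot> x \<in> carrier (free_alg n)" if "x \<in> carrier (free_alg n)" for c x
    using that by (auto simp: free_alg_def in_keys_iff)
  have sum: "(\<Sum>a\<in>A. f a) \<in> carrier (free_alg n)" if "\<And>a. a \<in> A \<Longrightarrow> f a \<in> carrier (free_alg n)"
    for A and f :: "int \<Rightarrow> _"
  proof -
    have "0 \<in> carrier (free_alg n)" by (simp add: free_alg_def)
    then show ?thesis
      using that by (induction A rule: infinite_finite_induct) (simp_all add: add)
  qed
  have one: "1 \<in> carrier (free_alg n)"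
    using R.one_closed by (simp add: free_alg_def)
  have neg: "- i \<in> idx n" if "i \<in> idx n" for i
    using that by (simp add: idx_def)
  have gen_t: "gen_t i j \<in> carrier (free_alg n)" if "i \<in> idx n" "j \<in> idx n" for i j
    using that by (auto simp: free_alg_def gen_t_def gens_def)
  have gen_tinv: "gen_tinv i \<in> carrier (free_alg n)" if "i \<in> idx n" for i
    using that by (auto simp: free_alg_def gen_tinv_def gens_def)
  have relator: "relator n i j k l \<in> carrier (free_alg n)"
    if "i \<in> idx n" "j \<in> idx n" "k \<in> idx n" "l \<in> idx n" for i j k l
    unfolding relator_def by (intro add minus mult scl sum gen_t neg that)
  show ?thesis
    unfolding relators_def by (safe; intro minus mult one gen_t gen_tinv neg relator)
qed

text \<open>
  Ideals of \<open>free_alg n\<close> are two-sided and closed under scalars, since the constants lie in the carrier.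
  The elements of \<open>Uqp n\<close> are cosets, that is, sets of representatives in \<open>free_alg n\<close>.
\<close>

definition Uqp :: "nat \<Rightarrow> (gen list \<Rightarrow>\<^sub>0 Cq) set ring" where
  "Uqp n = free_alg n Quot (Idl\<^bsub>free_alg n\<^esub> (relators n))"

lemma ring_Uqp: "ring (Uqp n)"
  unfolding Uqp_def
  by (intro ideal.quotient_is_ring ring.genideal_ideal ring_free_alg relators_subset)


section \<open>The tensor powers of the natural module\<close>

definition tensor_power :: "nat \<Rightarrow> nat \<Rightarrow> (int list \<Rightarrow>\<^sub>0 Cq) set" where
  "tensor_power n k = {x. \<forall>w\<in>Poly_Mapping.keys x. length w = k \<and> set w \<subseteq> idx n}"

text \<open>\<open>Emat i j a\<close> and \<open>EEmat i j a\<close> are the values at \<open>u\<^sub>a\<close> of the operators \<open>E\<^sub>i\<^sub>j\<close> and \<open>\<E>\<^sub>i\<^sub>j\<close>.\<close>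

definition Emat :: "int \<Rightarrow> int \<Rightarrow> int \<Rightarrow> (int list \<Rightarrow>\<^sub>0 Cq)" where
  "Emat i j a = (if j = a then Poly_Mapping.single [i] 1 else 0)"

definition EEmat :: "int \<Rightarrow> int \<Rightarrow> int \<Rightarrow> (int list \<Rightarrow>\<^sub>0 Cq)" where
  "EEmat i j a = Emat i j a - (-1) ^ (par i * (par j + 1)) \<cdot> Emat (- j) (- i) a"

definition t_vec :: "nat \<Rightarrow> int \<Rightarrow> int \<Rightarrow> int \<Rightarrow> (int list \<Rightarrow>\<^sub>0 Cq)" where
  "t_vec n i j a =
     (if j = i then
        \<Sum>b\<in>idx n. q powi (of_bool (b = i) * (1 - 2 * int (par i))
                          + of_bool (b = - i) * (2 * int (par i) - 1)) \<cdot> Emat b b a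
      else if j = - i then (qd * of_bool (i > 0)) \<cdot> Emat (- i) i a
      else if \<bar>i\<bar> < \<bar>j\<bar> then (qd * (-1) ^ par i) \<cdot> EEmat j i a
      else 0)"

text \<open>
  In the recursive equation the first sign is the one in \<open>\<Delta>(t\<^sub>i\<^sub>j) = \<Sum>m. \<plusminus> t\<^sub>i\<^sub>m \<otimes> t\<^sub>m\<^sub>j\<close>, the second comes from
  moving \<open>t\<^sub>m\<^sub>j\<close>, of parity \<open>par m + par j\<close>, past \<open>u\<^sub>a\<close>.  The equation for the empty word is the
  counit; it is not used for tensor powers of positive degree.
\<close>

fun t_word :: "nat \<Rightarrow> int \<Rightarrow> int \<Rightarrow> int list \<Rightarrow> (int list \<Rightarrow>\<^sub>0 Cq)" where
  "t_word n i j [] = of_bool (i = j)"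
| "t_word n i j [a] = t_vec n i j a"
| "t_word n i j (a # b # w) =
     (\<Sum>m\<in>idx n. ((-1) ^ ((par i + par m) * (par m + par j)) * (-1) ^ ((par m + par j) * par a))
        \<cdot> (t_vec n i m a * t_word n m j (b # w)))"

text \<open>\<open>Tinv i\<close> acts by the inverse of the operator of \<open>T i i\<close> on the tensor power.\<close>

definition gen_act :: "nat \<Rightarrow> nat \<Rightarrow> gen \<Rightarrow> (int list \<Rightarrow>\<^sub>0 Cq) \<Rightarrow> (int list \<Rightarrow>\<^sub>0 Cq)" where
  "gen_act n k g = (case g of
      T i j \<Rightarrow> lin_ext (t_word n i j)
    | Tinv i \<Rightarrow> inv_into (tensor_power n k) (lin_ext (t_word n i i)))"

text \<open>A word \<open>[g, h, \<dots>]\<close> is the product \<open>g h \<dots>\<close>, whose last factor acts first.\<close>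

definition act :: "nat \<Rightarrow> nat \<Rightarrow> (gen list \<Rightarrow>\<^sub>0 Cq) \<Rightarrow> (int list \<Rightarrow>\<^sub>0 Cq) \<Rightarrow> (int list \<Rightarrow>\<^sub>0 Cq)" where
  "act n k x v = lin_ext (\<lambda>w. foldr (gen_act n k) w v) x"

definition even_part :: "(int list \<Rightarrow>\<^sub>0 Cq) \<Rightarrow> (int list \<Rightarrow>\<^sub>0 Cq)" where
  "even_part v = lin_ext (\<lambda>w. if even (\<Sum>a\<leftarrow>w. par a) then Poly_Mapping.single w 1 else 0) v"

text \<open>
  Submodules of a module over a superalgebra are graded subspaces; a subspace is graded iff it is closed
  under taking even parts.  An element \<open>X\<close> of \<open>Uqp n\<close> acts on \<open>tensor_power n k\<close> by \<open>act n k x\<close>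
  for any representative \<open>x \<in> X\<close>.  The operators \<open>gen_act\<close> satisfy the defining relations on
  \<open>tensor_power n k\<close>, so the choice of \<open>x\<close> does not matter; stability is required for all
  representatives, and the definition therefore does not rest on that fact.
\<close>

definition submodule_Vk :: "nat \<Rightarrow> nat \<Rightarrow> (int list \<Rightarrow>\<^sub>0 Cq) set \<Rightarrow> bool" where
  "submodule_Vk n k N \<longleftrightarrow>
     N \<subseteq> tensor_power n k \<and> scl.subspace N \<and> even_part ` N \<subseteq> N \<and>
     (\<forall>X\<in>carrier (Uqp n). \<forall>x\<in>X. \<forall>v\<in>N. act n k x v \<in> N)"

definition irreducible_Vk :: "nat \<Rightarrow> nat \<Rightarrow> (int list \<Rightarrow>\<^sub>0 Cq) set \<Rightarrow> bool" where
  "irreducible_Vk n k N \<longleftrightarrow>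
     submodule_Vk n k N \<and> N \<noteq> {0} \<and> (\<forall>N'. submodule_Vk n k N' \<and> N' \<subseteq> N \<longrightarrow> N' = {0} \<or> N' = N)"

definition completely_reducible_Vk :: "nat \<Rightarrow> nat \<Rightarrow> bool" where
  "completely_reducible_Vk n k \<longleftrightarrow>
     (\<exists>\<S>. (\<forall>N\<in>\<S>. irreducible_Vk n k N) \<and>
          (\<forall>N\<in>\<S>. N \<inter> scl.span (\<Union>(\<S> - {N})) = {0}) \<and>
          scl.span (\<Union>\<S>) = tensor_power n k)"

end

theory Submission
  imports Defs
begin

text \<open>
  Let \<open>x = u\<^sub>1 \<otimes> \<dots> \<otimes> u\<^sub>1\<close>, which spans the top weight space of \<open>t\<^sub>1\<^sub>1\<close>.  In a
  decomposition of the tensor power into irreducibles, some summand \<open>N\<close> contains a vector in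
  which the word of \<open>x\<close> occurs, and projecting to the top weight space gives \<open>x \<in> N\<close>.  It
  therefore suffices to find a submodule \<open>J\<close> of vectors in which this word does not occur, and an
  element \<open>y\<close> of the algebra with \<open>0 \<noteq> y x \<in> J\<close>: then \<open>N \<inter> J\<close> is a nonzero proper
  submodule of \<open>N\<close>.

  The quotient by \<open>J\<close> is a homogeneous component of the \<open>q\<close>-symmetric algebra of \<open>V\<close>
  modulo the ideal generated by the invariant tensor
  \<open>c = \<Sum>\<^sub>i (u\<^sub>i \<otimes> u\<^bsub>-i\<^esub> + u\<^bsub>-i\<^esub> \<otimes> u\<^sub>i)\<close>, and \<open>y x\<close> is congruent to
  a multiple of \<open>c u\<^sub>1\<^bsup>k-2\<^esup>\<close> modulo the \<open>q\<close>-skew relations.  Dually, \<open>J\<close> is the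
  annihilator of a space of functionals on words that is described by quadratic conditions on
  adjacent letters, and it is this space that is shown to be stable under the \<open>t\<^sub>i\<^sub>j\<close>.
\<close>

section \<open>Functionals on words\<close>

text \<open>A linear functional on the span of words is an arbitrary function on words, with no
  support condition; finiteness comes from \<open>v\<close> alone.\<close>

definition pairing :: "('a \<Rightarrow> 'k) \<Rightarrow> ('a \<Rightarrow>\<^sub>0 'k::field) \<Rightarrow> 'k" where
  "pairing F v = (\<Sum>w\<in>Poly_Mapping.keys v. Poly_Mapping.lookup v w * F w)"

lemma pairing_superset:
  assumes "finite A" "Poly_Mapping.keys v \<subseteq> A"
  shows "pairing F v = (\<Sum>w\<in>A. Poly_Mapping.lookup v w * F w)"
  unfolding pairing_def
  by (rule sum.mono_neutral_left) (use assms in \<open>auto simp: in_keys_iff\<close>)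

lemma pairing_add: "pairing F (v + w) = pairing F v + pairing F w"
proof -
  let ?A = "Poly_Mapping.keys v \<union> Poly_Mapping.keys w"
  have "Poly_Mapping.keys (v + w) \<subseteq> ?A" by (rule Poly_Mapping.keys_add)
  then show ?thesis
    by (simp add: pairing_superset[of ?A] lookup_add sum.distrib ring_distribs)
qed

lemma pairing_scl [simp]: "pairing F (c \<cdot> v) = c * pairing F v"
proof -
  have "Poly_Mapping.keys (c \<cdot> v) \<subseteq> Poly_Mapping.keys v" by (auto simp: in_keys_iff)
  then show ?thesis
    by (simp add: pairing_superset[of "Poly_Mapping.keys v"] sum_distrib_left mult_ac)
qed

lemma pairing_zero [simp]: "pairing F 0 = 0"
  by (simp add: pairing_def)

lemma pairing_minus: "pairing F (v - w) = pairing F v - pairing F w"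
proof -
  have "v - w = v + (-1) \<cdot> w"
    by (rule poly_mapping_eqI) (simp add: lookup_add lookup_minus)
  then show ?thesis by (simp only: pairing_add pairing_scl) simp
qed

lemma pairing_sum: "pairing F (\<Sum>a\<in>A. f a) = (\<Sum>a\<in>A. pairing F (f a))"
  by (induction A rule: infinite_finite_induct) (simp_all add: pairing_add)

lemma pairing_single [simp]: "pairing F (Poly_Mapping.single w c) = c * F w"
  by (cases "c = 0") (simp_all add: pairing_def)

lemma pairing_one [simp]: "pairing F 1 = F 0"
  by (simp add: pairing_def)

lemma pairing_lin_ext [simp]: "pairing F (lin_ext f v) = pairing (\<lambda>w. pairing F (f w)) v"
  unfolding lin_ext_def pairing_sum pairing_scl by (simp add: pairing_def)

lemma sum_single_lookup:
  "(\<Sum>w\<in>Poly_Mapping.keys v. Poly_Mapping.single w (Poly_Mapping.lookup v w)) = v"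
  by (rule poly_mapping_eqI)
    (simp add: lookup_sum lookup_single when_def sum.delta not_in_keys_iff_lookup_eq_zero)

text \<open>On words \<open>+\<close> is concatenation, so a functional is evaluated on a product
  one tensor factor at a time. This turns the recursion of \<open>t_word\<close> into a recursion
  for functionals.\<close>

lemma pairing_mult:
  fixes x y :: "'a::monoid_add \<Rightarrow>\<^sub>0 'k::field"
  shows "pairing F (x * y) = pairing (\<lambda>u. pairing (\<lambda>v. F (u + v)) y) x"
proof -
  have 1: "pairing F (Poly_Mapping.single u c * y) = c * pairing (\<lambda>v. F (u + v)) y" for u c
  proof -
    have "Poly_Mapping.single u c * y =
        (\<Sum>w\<in>Poly_Mapping.keys y. Poly_Mapping.single (u + w) (c * Poly_Mapping.lookup y w))"
      by (subst sum_single_lookup[of y, symmetric]) (simp add: sum_distrib_left mult_single)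
    then show ?thesis
      by (simp add: pairing_sum) (simp add: pairing_def sum_distrib_left mult_ac)
  qed
  have "x * y = (\<Sum>u\<in>Poly_Mapping.keys x. Poly_Mapping.single u (Poly_Mapping.lookup x u) * y)"
    by (subst sum_single_lookup[of x, symmetric]) (simp add: sum_distrib_right)
  then show ?thesis
    by (simp add: pairing_sum 1) (simp add: pairing_def)
qed

lemma pairing_cong: "(\<And>w. w \<in> Poly_Mapping.keys v \<Longrightarrow> F w = H w) \<Longrightarrow> pairing F v = pairing H v"
  by (simp add: pairing_def)

lemma pairing_scale_left: "pairing (\<lambda>w. c * F w) v = c * pairing F v"
  by (simp add: pairing_def sum_distrib_left mult_ac)

lemma pairing_zero_left [simp]: "pairing (\<lambda>w. 0) v = 0"
  by (simp add: pairing_def)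

section \<open>The action of the generators, transposed to functionals\<close>

lemma finite_idx [simp]: "finite (idx n)"
  by (rule finite_subset[of _ "{- int n..int n}"]) (auto simp: idx_def)

lemma idx_uminus [simp]: "- i \<in> idx n \<longleftrightarrow> i \<in> idx n"
  by (simp add: idx_def)

lemma idx_nonzero: "i \<in> idx n \<Longrightarrow> i \<noteq> 0"
  by (auto simp: idx_def)

text \<open>The eigenvalue of \<open>t\<^sub>i\<^sub>i\<close> on \<open>u\<^sub>a\<close>; only the
  absolute value of \<open>i\<close> matters.\<close>

definition dq :: "int \<Rightarrow> int \<Rightarrow> Cq" where
  "dq i a = (if \<bar>a\<bar> = \<bar>i\<bar> then if a > 0 then q else inverse q else 1)"

text \<open>The transpose of \<open>t\<^sub>i\<^sub>j\<close> on \<open>V\<close>: the functional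
  \<open>h\<close> composed with \<open>t\<^sub>i\<^sub>j\<close>, at \<open>u\<^sub>a\<close>.
  Taking \<open>h\<close> as a function of one letter allows nesting over several tensor
  factors.\<close>

definition vec_form :: "int \<Rightarrow> int \<Rightarrow> int \<Rightarrow> (int \<Rightarrow> Cq) \<Rightarrow> Cq" where
  "vec_form i j a h =
     (if j = i then dq i a * h a
      else if j = - i then of_bool (i > 0 \<and> a = i) * qd * h (- i)
      else if \<bar>i\<bar> < \<bar>j\<bar> then qd * (-1) ^ par i *
        (of_bool (a = i) * h j - (-1) ^ (par j * (par i + 1)) * of_bool (a = - j) * h (- i))
      else 0)"

lemma pairing_t_vec:
  assumes "i \<in> idx n" "j \<in> idx n" "a \<in> idx n"
  shows "pairing h (t_vec n i j a) = vec_form i j a (\<lambda>c. h [c])"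
proof -
  have E: "pairing h (Emat b c a) = of_bool (a = c) * h [b]" for b c
    by (auto simp: Emat_def)
  have "pairing h (\<Sum>b\<in>idx n. q powi (of_bool (b = i) * (1 - 2 * int (par i))
       + of_bool (b = - i) * (2 * int (par i) - 1)) \<cdot> Emat b b a) =
      (\<Sum>b\<in>idx n. if b = a then q powi (of_bool (a = i) * (1 - 2 * int (par i))
       + of_bool (a = - i) * (2 * int (par i) - 1)) * h [a] else 0)"
    unfolding pairing_sum pairing_scl E by (rule sum.cong) auto
  also have "\<dots> = dq i a * h [a]"
    using assms idx_nonzero[of i] idx_nonzero[of a]
    by (auto simp: dq_def par_def power_int_minus abs_eq_iff)
  finally have D: "pairing h (\<Sum>b\<in>idx n. q powi (of_bool (b = i) * (1 - 2 * int (par i))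
       + of_bool (b = - i) * (2 * int (par i) - 1)) \<cdot> Emat b b a) = dq i a * h [a]" .
  consider "j = i" | "j \<noteq> i" "j = - i" | "j \<noteq> i" "j \<noteq> - i" by blast
  then show ?thesis
  proof cases
    case 1
    show ?thesis
      unfolding t_vec_def vec_form_def if_P[OF 1] D ..
  next
    case 2
    then show ?thesis
      unfolding t_vec_def vec_form_def by (simp add: E)
  next
    case 3
    then show ?thesis
      unfolding t_vec_def vec_form_def
      by (simp add: EEmat_def pairing_minus E)
  qed
qed

lemma vec_form_sum: "vec_form i j a (\<lambda>c. \<Sum>x\<in>A. h x c) = (\<Sum>x\<in>A. vec_form i j a (h x))"
  by (induction A rule: infinite_finite_induct) (auto simp: vec_form_def algebra_simps)

lemma vec_form_scale: "vec_form i j a (\<lambda>c. k * h c) = k * vec_form i j a h"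
  by (auto simp: vec_form_def algebra_simps)

text \<open>
  The sign of the \<open>m\<close>-th summand when \<open>t\<^sub>i\<^sub>j\<close> is applied to a tensor whose first factor has
  parity \<open>p\<close>.
\<close>

definition sgm :: "int \<Rightarrow> int \<Rightarrow> int \<Rightarrow> nat \<Rightarrow> Cq" where
  "sgm i m j p = (-1) ^ ((par i + par m) * (par m + par j) + (par m + par j) * p)"

text \<open>The counit value at the empty word makes one recursion valid for all nonempty words: for
  a single letter only \<open>m = j\<close> survives, with sign 1.\<close>

lemma t_word_Cons:
  assumes "j \<in> idx n"
  shows "t_word n i j (a # w) = (\<Sum>m\<in>idx n. sgm i m j (par a) \<cdot> (t_vec n i m a * t_word n m j w))"
proof (cases w)
  case Nil
  have "(\<Sum>m\<in>idx n. sgm i m j (par a) \<cdot> (t_vec n i m a * t_word n m j [])) =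
      (\<Sum>m\<in>idx n. if m = j then t_vec n i j a else 0)"
    by (rule sum.cong) (auto simp: sgm_def par_def)
  then show ?thesis using Nil assms by simp
next
  case (Cons b w')
  then show ?thesis by (simp add: sgm_def power_add)
qed

text \<open>The right action of \<open>t\<^sub>i\<^sub>j\<close> on functionals, dual to its action
  on tensors.\<close>

definition t_form :: "nat \<Rightarrow> int \<Rightarrow> int \<Rightarrow> (int list \<Rightarrow> Cq) \<Rightarrow> int list \<Rightarrow> Cq" where
  "t_form n i j F w = pairing F (t_word n i j w)"

lemma pairing_t_word: "pairing F (lin_ext (t_word n i j) v) = pairing (t_form n i j F) v"
  by (simp add: t_form_def[abs_def])

lemma t_form_Nil [simp]: "t_form n i j F [] = of_bool (i = j) * F []"
  by (simp add: t_form_def zero_list_def)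

lemma t_form_Cons:
  assumes "i \<in> idx n" "j \<in> idx n" "a \<in> idx n"
  shows "t_form n i j F (a # w) = (\<Sum>m\<in>idx n. sgm i m j (par a) *
           vec_form i m a (\<lambda>c. t_form n m j (\<lambda>v. F (c # v)) w))"
  unfolding t_form_def t_word_Cons[OF assms(2)] pairing_sum pairing_scl pairing_mult
  by (rule sum.cong) (simp_all add: pairing_t_vec assms plus_list_def)

section \<open>Bilinear forms on the natural module\<close>

lemma q_nonzero [simp]: "q \<noteq> 0"
  by (simp add: q_def Zero_fract_def eq_fract)

text \<open>
  The forms on \<open>V \<otimes> V\<close> that vanish on the \<open>q\<close>-skew tensors and on \<open>c\<close>.  The numbers
  \<open>r s\<close> parametrise the values in weight zero; \<open>r 0 = r n = 0\<close> makes these values telescope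
  to zero on \<open>c\<close>.
\<close>

definition qs_forms :: "nat \<Rightarrow> (int \<Rightarrow> int \<Rightarrow> Cq) set" where
  "qs_forms n = {\<nu>.
     (\<forall>a\<in>idx n. \<forall>b\<in>idx n. \<bar>a\<bar> < \<bar>b\<bar> \<longrightarrow> \<nu> b a = (-1) ^ (par a * par b) * inverse q * \<nu> a b) \<and>
     (\<forall>a\<in>idx n. a < 0 \<longrightarrow> \<nu> a a = 0) \<and>
     (\<exists>r. r 0 = 0 \<and> r (int n) = 0 \<and> (\<forall>s. 1 \<le> s \<and> s \<le> int n \<longrightarrow>
        \<nu> s (- s) = r (s - 1) - q\<^sup>2 * r s \<and> \<nu> (- s) s = q\<^sup>2 * r (s - 1) - r s))}"

lemma qs_forms_swap:
  assumes "\<nu> \<in> qs_forms n" "a \<in> idx n" "b \<in> idx n" "\<bar>a\<bar> < \<bar>b\<bar>"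
  shows "\<nu> b a = (-1) ^ (par a * par b) * inverse q * \<nu> a b"
  using assms by (simp add: qs_forms_def)

lemma qs_forms_diag: "\<nu> \<in> qs_forms n \<Longrightarrow> a \<in> idx n \<Longrightarrow> a < 0 \<Longrightarrow> \<nu> a a = 0"
  by (simp add: qs_forms_def)

lemma qs_forms_potential:
  assumes "\<nu> \<in> qs_forms n"
  obtains r where "r 0 = 0" "r (int n) = 0"
    "\<And>s. 1 \<le> s \<Longrightarrow> s \<le> int n \<Longrightarrow> \<nu> s (- s) = r (s - 1) - q\<^sup>2 * r s"
    "\<And>s. 1 \<le> s \<Longrightarrow> s \<le> int n \<Longrightarrow> \<nu> (- s) s = q\<^sup>2 * r (s - 1) - r s"
  using assms unfolding qs_forms_def by blast

lemma qs_formsI: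
  assumes "\<And>a b. a \<in> idx n \<Longrightarrow> b \<in> idx n \<Longrightarrow> \<bar>a\<bar> < \<bar>b\<bar> \<Longrightarrow>
      \<nu> b a = (-1) ^ (par a * par b) * inverse q * \<nu> a b"
    and "\<And>a. a \<in> idx n \<Longrightarrow> a < 0 \<Longrightarrow> \<nu> a a = 0"
    and "r 0 = 0" "r (int n) = 0"
    and "\<And>s. 1 \<le> s \<Longrightarrow> s \<le> int n \<Longrightarrow> \<nu> s (- s) = r (s - 1) - q\<^sup>2 * r s"
    and "\<And>s. 1 \<le> s \<Longrightarrow> s \<le> int n \<Longrightarrow> \<nu> (- s) s = q\<^sup>2 * r (s - 1) - r s"
  shows "\<nu> \<in> qs_forms n"
  unfolding qs_forms_def using assms by blast

lemma qs_forms_zero: "(\<lambda>a b. 0) \<in> qs_forms n"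
  by (rule qs_formsI[where r = "\<lambda>_. 0"]) auto

lemma qs_forms_add:
  assumes "\<mu> \<in> qs_forms n" "\<nu> \<in> qs_forms n"
  shows "(\<lambda>a b. \<mu> a b + \<nu> a b) \<in> qs_forms n"
proof -
  obtain r where r: "r 0 = 0" "r (int n) = 0"
    "\<And>s. 1 \<le> s \<Longrightarrow> s \<le> int n \<Longrightarrow> \<mu> s (- s) = r (s - 1) - q\<^sup>2 * r s"
    "\<And>s. 1 \<le> s \<Longrightarrow> s \<le> int n \<Longrightarrow> \<mu> (- s) s = q\<^sup>2 * r (s - 1) - r s"
    by (rule qs_forms_potential[OF assms(1)]) blast
  obtain t where t: "t 0 = 0" "t (int n) = 0"
    "\<And>s. 1 \<le> s \<Longrightarrow> s \<le> int n \<Longrightarrow> \<nu> s (- s) = t (s - 1) - q\<^sup>2 * t s"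
    "\<And>s. 1 \<le> s \<Longrightarrow> s \<le> int n \<Longrightarrow> \<nu> (- s) s = q\<^sup>2 * t (s - 1) - t s"
    by (rule qs_forms_potential[OF assms(2)]) blast
  show ?thesis
    by (rule qs_formsI[where r = "\<lambda>s. r s + t s"])
      (use qs_forms_swap[OF assms(1)] qs_forms_swap[OF assms(2)]
         qs_forms_diag[OF assms(1)] qs_forms_diag[OF assms(2)] in
       \<open>simp_all add: r t algebra_simps\<close>)
qed

lemma qs_forms_scale:
  assumes "\<nu> \<in> qs_forms n"
  shows "(\<lambda>a b. c * \<nu> a b) \<in> qs_forms n"
proof -
  obtain r where r: "r 0 = 0" "r (int n) = 0"
    "\<And>s. 1 \<le> s \<Longrightarrow> s \<le> int n \<Longrightarrow> \<nu> s (- s) = r (s - 1) - q\<^sup>2 * r s"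
    "\<And>s. 1 \<le> s \<Longrightarrow> s \<le> int n \<Longrightarrow> \<nu> (- s) s = q\<^sup>2 * r (s - 1) - r s"
    by (rule qs_forms_potential[OF assms]) blast
  show ?thesis
    by (rule qs_formsI[where r = "\<lambda>s. c * r s"])
      (use qs_forms_swap[OF assms] qs_forms_diag[OF assms] in \<open>simp_all add: r algebra_simps\<close>)
qed

lemma qs_forms_sum:
  assumes "\<And>x. x \<in> A \<Longrightarrow> \<nu> x \<in> qs_forms n"
  shows "(\<lambda>a b. \<Sum>x\<in>A. \<nu> x a b) \<in> qs_forms n"
  using assms
  by (induction A rule: infinite_finite_induct)
    (simp_all add: qs_forms_zero qs_forms_add)

text \<open>All defining relations of \<open>qs_forms n\<close> are homogeneous for such characters.\<close>

lemma qs_forms_twist: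
  assumes "\<nu> \<in> qs_forms n" and \<phi>: "\<And>a. a \<in> idx n \<Longrightarrow> \<phi> a * \<phi> (- a) = c"
  shows "(\<lambda>a b. \<phi> a * \<phi> b * \<nu> a b) \<in> qs_forms n"
proof -
  obtain r where r: "r 0 = 0" "r (int n) = 0"
    "\<And>s. 1 \<le> s \<Longrightarrow> s \<le> int n \<Longrightarrow> \<nu> s (- s) = r (s - 1) - q\<^sup>2 * r s"
    "\<And>s. 1 \<le> s \<Longrightarrow> s \<le> int n \<Longrightarrow> \<nu> (- s) s = q\<^sup>2 * r (s - 1) - r s"
    by (rule qs_forms_potential[OF assms(1)]) blast
  have c: "\<phi> s * \<phi> (- s) = c" "\<phi> (- s) * \<phi> s = c" if "1 \<le> s" "s \<le> int n" for s
    using \<phi>[of s] that by (simp_all add: idx_def mult.commute)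
  show ?thesis
  proof (rule qs_formsI[where r = "\<lambda>s. c * r s"])
    fix a b assume "a \<in> idx n" "b \<in> idx n" "\<bar>a\<bar> < \<bar>b\<bar>"
    then show "\<phi> b * \<phi> a * \<nu> b a = (-1) ^ (par a * par b) * inverse q * (\<phi> a * \<phi> b * \<nu> a b)"
      by (simp add: qs_forms_swap[OF assms(1)])
  qed (use qs_forms_diag[OF assms(1)] in \<open>simp_all add: r c right_diff_distrib mult.left_commute\<close>)
qed

section \<open>Explicit formulas for the action on bilinear forms\<close>

lemma sgm_left: "sgm i i j p = (-1) ^ ((par i + par j) * p)"
  by (simp add: sgm_def power_add power_mult flip: mult_2)

lemma sgm_right: "sgm i j j p = 1"
  by (simp add: sgm_def)

text \<open>The right action of \<open>t\<^sub>i\<^sub>j\<close> on forms, through the comultiplication.\<close>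

definition form2 :: "nat \<Rightarrow> int \<Rightarrow> int \<Rightarrow> (int \<Rightarrow> int \<Rightarrow> Cq) \<Rightarrow> int \<Rightarrow> int \<Rightarrow> Cq" where
  "form2 n i j \<nu> a b =
     (\<Sum>m\<in>idx n. sgm i m j (par a) * vec_form i m a (\<lambda>c. vec_form m j b (\<nu> c)))"

definition between :: "int \<Rightarrow> int \<Rightarrow> int set" where
  "between i j = {m. \<bar>i\<bar> < \<bar>m\<bar> \<and> \<bar>m\<bar> < \<bar>j\<bar>}"

lemma finite_between [simp]: "finite (between i j)"
  by (rule finite_subset[of _ "{- \<bar>j\<bar>..\<bar>j\<bar>}"]) (auto simp: between_def)

text \<open>By triangularity only \<open>m = i\<close> and \<open>m = - i\<close> can contribute,
  and for \<open>m = - i\<close> one of the two factors vanishes, whatever the sign of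
  \<open>i\<close>.\<close>

lemma form2_same:
  assumes "i \<in> idx n"
  shows "form2 n i i \<nu> a b = dq i a * dq i b * \<nu> a b"
proof -
  have "form2 n i i \<nu> a b = (\<Sum>m\<in>idx n. if m = i then dq i a * dq i b * \<nu> a b else 0)"
    unfolding form2_def
    by (rule sum.cong) (auto simp: vec_form_def sgm_def par_def)
  then show ?thesis using assms by simp
qed

lemma vec_form_gt:
  assumes "\<bar>j\<bar> < \<bar>i\<bar>"
  shows "vec_form i j a h = 0"
proof -
  have "j \<noteq> i" "j \<noteq> - i" "\<not> \<bar>i\<bar> < \<bar>j\<bar>" using assms by auto
  then show ?thesis by (simp add: vec_form_def)
qed

lemma vec_form_same: "vec_form i i a h = dq i a * h a"
  by (simp add: vec_form_def)

lemma vec_form_opp: "i \<noteq> 0 \<Longrightarrow> vec_form i (- i) a h = of_bool (i > 0 \<and> a = i) * qd * h (- i)"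
  by (simp add: vec_form_def)

lemma vec_form_less:
  assumes "\<bar>i\<bar> < \<bar>j\<bar>"
  shows "vec_form i j a h = qd * (-1) ^ par i *
    (of_bool (a = i) * h j - (-1) ^ (par j * (par i + 1)) * of_bool (a = - j) * h (- i))"
proof -
  have "j \<noteq> i" "j \<noteq> - i" using assms by auto
  then show ?thesis using assms by (simp add: vec_form_def)
qed

lemma vec_form_zero: "vec_form i j a (\<lambda>c. 0) = 0"
  by (simp add: vec_form_def)

lemma form2_gt:
  assumes "\<bar>j\<bar> < \<bar>i\<bar>"
  shows "form2 n i j \<nu> a b = 0"
  unfolding form2_def
proof (rule sum.neutral, rule ballI)
  fix m
  have "\<bar>m\<bar> < \<bar>i\<bar> \<or> \<bar>j\<bar> < \<bar>m\<bar>" using assms by linarith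
  then show "sgm i m j (par a) * vec_form i m a (\<lambda>c. vec_form m j b (\<nu> c)) = 0"
    by (elim disjE) (simp_all only: vec_form_gt vec_form_zero mult_zero_right)
qed

lemma form2_opp_neg:
  assumes "i < 0"
  shows "form2 n i (- i) \<nu> a b = 0"
  unfolding form2_def
  by (rule sum.neutral) (use assms in \<open>auto simp: vec_form_def\<close>)

lemma form2_opp:
  assumes "i \<in> idx n" "i > 0"
  shows "form2 n i (- i) \<nu> a b = qd * ((-1) ^ par a * dq i a * of_bool (b = i) * \<nu> a (- i)
           + of_bool (a = i) * dq i b * \<nu> (- i) b)"
proof -
  let ?f = "\<lambda>m. sgm i m (- i) (par a) * vec_form i m a (\<lambda>c. vec_form m (- i) b (\<nu> c))"
  have "form2 n i (- i) \<nu> a b = (\<Sum>m\<in>{i, - i}. ?f m)"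
    unfolding form2_def
    by (rule sum.mono_neutral_right) (use assms in \<open>auto simp: vec_form_def\<close>)
  also have "\<dots> = ?f i + ?f (- i)" using assms by simp
  finally show ?thesis using assms
    by (simp add: vec_form_def sgm_def par_def dq_def algebra_simps)
qed

text \<open>Triangularity leaves the \<open>m\<close> with |i| <= |m| <= |j|. The terms
  \<open>m = i\<close> and \<open>m = j\<close> form the first summand, \<open>m = - i\<close>
  contributes only for \<open>i > 0\<close> and \<open>m = - j\<close> only for
  \<open>j < 0\<close>, and the last summand collects the \<open>m\<close> in
  \<open>between i j\<close>. There each factor consists of two matrix units, so all sums collapse
  except the one over \<open>\<nu> m (- m)\<close>.\<close>

lemma form2_less:
  assumes "i \<in> idx n" "j \<in> idx n" "\<bar>i\<bar> < \<bar>j\<bar>"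
  shows "form2 n i j \<nu> a b =
      qd * (-1) ^ par i * ((-1) ^ ((par i + par j) * par a) * dq i a *
          (of_bool (b = i) * \<nu> a j - (-1) ^ (par j * (par i + 1)) * of_bool (b = - j) * \<nu> a (- i))
        + dq j b *
          (of_bool (a = i) * \<nu> j b - (-1) ^ (par j * (par i + 1)) * of_bool (a = - j) * \<nu> (- i) b))
    + of_bool (i > 0 \<and> a = i) * qd\<^sup>2 * (-1) ^ par j *
        (of_bool (b = - i) * \<nu> (- i) j - of_bool (b = - j) * \<nu> (- i) i)
    + of_bool (j < 0 \<and> b = - j) * qd\<^sup>2 * (-1) ^ par a *
        (of_bool (a = i) * \<nu> (- j) j - of_bool (a = j) * \<nu> (- i) j)
    + qd\<^sup>2 * (-1) ^ par i *
        (of_bool (a = i \<and> b \<in> between i j) * (-1) ^ (par b * par j) * \<nu> b j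
         - of_bool (a = i \<and> b = - j) * (-1) ^ par j * (\<Sum>m\<in>between i j. \<nu> m (- m))
         - of_bool (b = - a \<and> a \<in> between i j) * (-1) ^ (par j * (par i + 1) + par b) * \<nu> (- i) j
         + of_bool (b = - j \<and> a \<in> between i j) *
             (-1) ^ (par i * par j + 1 + par a + par j + par j * par a) * \<nu> (- i) a)"
    (is "_ = ?I + ?I' + ?J' + ?M")
proof -
  let ?f = "\<lambda>m. sgm i m j (par a) * vec_form i m a (\<lambda>c. vec_form m j b (\<nu> c))"
  let ?s = "(-1) ^ par i :: Cq"
  have i: "i \<noteq> 0" and j: "j \<noteq> 0" using assms idx_nonzero by auto
  have sub: "{i, - i, j, - j} \<union> between i j \<subseteq> idx n"
    using assms by (auto simp: between_def idx_def)
  have "form2 n i j \<nu> a b = (\<Sum>m\<in>{i, - i, j, - j} \<union> between i j. ?f m)"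
    unfolding form2_def
  proof (rule sum.mono_neutral_right)
    show "\<forall>m\<in>idx n - ({i, - i, j, - j} \<union> between i j). ?f m = 0"
    proof
      fix m assume "m \<in> idx n - ({i, - i, j, - j} \<union> between i j)"
      then have "\<bar>m\<bar> < \<bar>i\<bar> \<or> \<bar>j\<bar> < \<bar>m\<bar>" by (auto simp: between_def abs_if split: if_splits)
      then show "?f m = 0"
        by (elim disjE) (simp_all only: vec_form_gt vec_form_zero mult_zero_right)
    qed
  qed (use sub in auto)
  also have "\<dots> = (\<Sum>m\<in>{i, - i, j, - j}. ?f m) + (\<Sum>m\<in>between i j. ?f m)"
    by (rule sum.union_disjoint; simp) (auto simp: between_def)
  also have "(\<Sum>m\<in>{i, - i, j, - j}. ?f m) = ?f i + ?f j + ?f (- i) + ?f (- j)"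
  proof -
    have "i \<noteq> - i" "j \<noteq> - j" "i \<noteq> j" "i \<noteq> - j" "- i \<noteq> j" using i j assms(3) by auto
    then show ?thesis by simp
  qed
  also have "?f i + ?f j = ?I"
    unfolding vec_form_same vec_form_less[OF assms(3)] sgm_left sgm_right
    by (simp only: ring_distribs mult_ac mult_1 mult_1_right)
  also have "?f (- i) = ?I'"
  proof -
    have "\<bar>- i\<bar> < \<bar>j\<bar>" using assms(3) by simp
    note less = vec_form_less[OF this]
    show ?thesis
    proof (cases "i > 0 \<and> a = i")
      case True
      then show ?thesis
        by (cases "j > 0") (simp_all add: vec_form_opp less sgm_def par_def power2_eq_square
            algebra_simps)
    next
      case False
      then show ?thesis using i by (simp add: vec_form_opp)
    qed
  qed
  also have "?f (- j) = ?J'"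
  proof -
    have "\<bar>i\<bar> < \<bar>- j\<bar>" using assms(3) by simp
    note less = vec_form_less[OF this]
    have opp: "vec_form (- j) j c h = of_bool (j < 0 \<and> c = - j) * qd * h j" for c h
      using vec_form_opp[of "- j" c h] j by simp
    show ?thesis
    proof (cases "j < 0 \<and> b = - j")
      case True
      then show ?thesis
        by (cases "i > 0") (simp_all add: opp less sgm_def par_def power2_eq_square algebra_simps)
    next
      case False
      then show ?thesis by (auto simp: opp less)
    qed
  qed
  also have "(\<Sum>m\<in>between i j. ?f m) = ?M"
  proof -
    have "?f m = qd\<^sup>2 * ?s *
        ((if m = b then of_bool (a = i) * (-1) ^ (par b * par j) * \<nu> b j else 0)
         - of_bool (a = i \<and> b = - j) * (-1) ^ par j * \<nu> m (- m)
         - (if m = - a then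
             of_bool (b = - a) * (-1) ^ (par j * (par i + 1) + par b) * \<nu> (- i) j else 0)
         + (if m = - a then of_bool (b = - j) *
             (-1) ^ (par i * par j + 1 + par a + par j + par j * par a) * \<nu> (- i) a else 0))"
      if m: "m \<in> between i j" for m
    proof -
      have less: "\<bar>i\<bar> < \<bar>m\<bar>" "\<bar>m\<bar> < \<bar>j\<bar>" using m by (auto simp: between_def)
      then have nz: "m \<noteq> 0" "- m \<noteq> i" "i \<noteq> - m" "m \<noteq> j" "m \<noteq> - j" "j \<noteq> - m" by auto
      note form = vec_form_less[OF less(1)] vec_form_less[OF less(2)]
      \<comment> \<open>An opaque name keeps the simplifier from expanding the difference
        \<open>qd\<close>.\<close>
      obtain d where d: "d = qd" by simp
      have par: "par x = 0 \<or> par x = 1" for x by (simp add: par_def)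
      have par_m: "par (- m) = 1 - par m" using nz by (simp add: par_def)
      note signs = par[of i] par[of j] par[of m]
      \<comment> \<open>The first factor vanishes unless \<open>a = i\<close> or
        \<open>a = - m\<close>.\<close>
      consider "a = i" "m = b" | "a = i" "m \<noteq> b" | "a \<noteq> i" "m = - a" | "a \<noteq> i" "m \<noteq> - a" by blast
      then show ?thesis
      proof cases
        case 1
        have eq: "a = i" "b = m" "(m = m) = True" "(m = - i) = False" "(m = - j) = False"
            "(i = - m) = False"
          using 1 nz by auto
        show ?thesis
          unfolding form sgm_def d[symmetric] eq using signs by (elim disjE)
              (simp_all add: power2_eq_square)
      next
        case 2
        have eq: "a = i" "(b = m) = False" "(m = b) = False" "(m = - i) = False" "(i = - m) = False"
          using 2 nz by auto
        show ?thesis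
          unfolding form sgm_def d[symmetric] eq using signs by (elim disjE)
              (simp_all add: power2_eq_square)
      next
        case 3
        have eq: "a = - m" "(- m = i) = False" "(m = - (- m)) = True" "- (- m) = m" "m = b \<longleftrightarrow> b = m"
          using 3 nz by auto
        show ?thesis
          unfolding form sgm_def d[symmetric] eq par_m using signs
          by (elim disjE; cases "b = m") (simp_all add: power2_eq_square)
      next
        case 4
        then have "a \<noteq> - m" by simp
        with 4 show ?thesis by (simp add: form)
      qed
    qed
    then have "(\<Sum>m\<in>between i j. ?f m) = (\<Sum>m\<in>between i j. qd\<^sup>2 * ?s *
        ((if m = b then of_bool (a = i) * (-1) ^ (par b * par j) * \<nu> b j else 0)
         - of_bool (a = i \<and> b = - j) * (-1) ^ par j * \<nu> m (- m)
         - (if m = - a then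
             of_bool (b = - a) * (-1) ^ (par j * (par i + 1) + par b) * \<nu> (- i) j else 0)
         + (if m = - a then of_bool (b = - j) *
             (-1) ^ (par i * par j + 1 + par a + par j + par j * par a) * \<nu> (- i) a else 0)))"
      by (rule sum.cong[OF refl])
    also have "\<dots> = ?M"
      unfolding sum_distrib_left[symmetric] sum.distrib sum_subtractf sum.delta[OF finite_between]
      by (auto simp: between_def)
    finally show ?thesis .
  qed
  finally show ?thesis by (simp only: add.assoc)
qed

section \<open>Stability of the bilinear forms under all generators\<close>

text \<open>The terms for \<open>s\<close> and \<open>- s\<close> add up to
  \<open>(1 + q\<^sup>2) * (r (s - 1) - r s)\<close>, which telescopes; the last \<open>s\<close> is
  |j| - 1.\<close>

lemma sum_between_qs_forms:
  assumes r: "\<And>s. 1 \<le> s \<Longrightarrow> s \<le> int n \<Longrightarrow> \<nu> s (- s) = r (s - 1) - q\<^sup>2 * r s"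
    "\<And>s. 1 \<le> s \<Longrightarrow> s \<le> int n \<Longrightarrow> \<nu> (- s) s = q\<^sup>2 * r (s - 1) - r s"
    and "\<bar>j\<bar> \<le> int n" "\<bar>i\<bar> < \<bar>j\<bar>"
  shows "(\<Sum>m\<in>between i j. \<nu> m (- m)) = (1 + q\<^sup>2) * (r \<bar>i\<bar> - r (\<bar>j\<bar> - 1))"
proof -
  \<comment> \<open>The upper end is written as |i| + 1 + d to allow induction on the number
    \<open>d\<close> of values of |m|.\<close>
  have "(\<Sum>m\<in>between i (\<bar>i\<bar> + 1 + int d). \<nu> m (- m)) = (1 + q\<^sup>2) * (r \<bar>i\<bar> - r (\<bar>i\<bar> + int d))"
    if "\<bar>i\<bar> + int d < int n" for d
    using that
  proof (induction d)
    case 0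
    have "between i (\<bar>i\<bar> + 1 + int 0) = {}" by (auto simp: between_def)
    then show ?case by simp
  next
    case (Suc d)
    let ?s = "\<bar>i\<bar> + 1 + int d"
    have "between i (\<bar>i\<bar> + 1 + int (Suc d)) = insert ?s (insert (- ?s) (between i ?s))"
      by (auto simp: between_def)
    moreover have "?s \<notin> insert (- ?s) (between i ?s)" "- ?s \<notin> between i ?s"
      by (auto simp: between_def)
    ultimately have "(\<Sum>m\<in>between i (\<bar>i\<bar> + 1 + int (Suc d)). \<nu> m (- m)) =
        \<nu> ?s (- ?s) + (\<nu> (- ?s) (- (- ?s)) + (\<Sum>m\<in>between i ?s. \<nu> m (- m)))"
      by (simp only: sum.insert finite_between finite_insert simp_thms)
    also have "\<dots> = (r (?s - 1) - q\<^sup>2 * r ?s) + ((q\<^sup>2 * r (?s - 1) - r ?s) +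
        (1 + q\<^sup>2) * (r \<bar>i\<bar> - r (\<bar>i\<bar> + int d)))"
      unfolding minus_minus using Suc r[of ?s] by simp
    also have "\<dots> = (1 + q\<^sup>2) * (r \<bar>i\<bar> - r (\<bar>i\<bar> + int (Suc d)))"
    proof -
      have "?s - 1 = \<bar>i\<bar> + int d" "?s = \<bar>i\<bar> + int (Suc d)" by simp_all
      then show ?thesis by (simp only:) (simp add: algebra_simps)
    qed
    finally show ?case .
  qed
  from this[of "nat (\<bar>j\<bar> - \<bar>i\<bar> - 1)"] assms(3,4)
  have "(\<Sum>m\<in>between i \<bar>j\<bar>. \<nu> m (- m)) = (1 + q\<^sup>2) * (r \<bar>i\<bar> - r (\<bar>j\<bar> - 1))"
    by simp
  moreover have "between i \<bar>j\<bar> = between i j" by (simp add: between_def)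
  ultimately show ?thesis by simp
qed

text \<open>At the pairs \<open>s, - s\<close> only \<open>\<nu> (- i) (- i)\<close> can occur,
  which is zero since \<open>- i < 0\<close>; so the zero potential serves for the new form.\<close>

lemma form2_opp_qs_forms:
  assumes "\<nu> \<in> qs_forms n" "i \<in> idx n" "i > 0"
  shows "form2 n i (- i) \<nu> \<in> qs_forms n"
proof (rule qs_formsI[where r = "\<lambda>_. 0"])
  note form = form2_opp[OF assms(2,3)]
  note swap = qs_forms_swap[OF assms(1)]
  fix a b assume ab: "a \<in> idx n" "b \<in> idx n" "\<bar>a\<bar> < \<bar>b\<bar>"
  consider "a = i" | "b = i" | "a \<noteq> i" "b \<noteq> i" by blast
  then show "form2 n i (- i) \<nu> b a = (-1) ^ (par a * par b) * inverse q * form2 n i (- i) \<nu> a b"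
  proof cases
    case 1
    then show ?thesis
      using ab assms swap[of "- i" b] by (cases "b > 0") (auto simp: form dq_def par_def)
  next
    case 2
    then show ?thesis
      using ab assms swap[of a "- i"] by (cases "a > 0") (auto simp: form dq_def par_def)
  qed (simp add: form)
next
  note form = form2_opp[OF assms(2,3)]
  have diag: "\<nu> (- i) (- i) = 0" using qs_forms_diag[OF assms(1), of "- i"] assms by simp
  show "form2 n i (- i) \<nu> a a = 0" if "a \<in> idx n" "a < 0" for a
    using that assms by (simp add: form)
  fix s assume s: "1 \<le> s" "s \<le> int n"
  show "form2 n i (- i) \<nu> s (- s) = 0 - q\<^sup>2 * 0" "form2 n i (- i) \<nu> (- s) s = q\<^sup>2 * 0 - 0"
    using s assms(3) by (auto simp: form diag)
qed simp_all

text \<open>The coefficient of \<open>\<nu> (- i) j\<close> in the potential of \<open>form2 n i j \<nu>\<close> at \<open>s\<close>.\<close>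

definition potential_coeff :: "int \<Rightarrow> int \<Rightarrow> int \<Rightarrow> Cq" where
  "potential_coeff i j s = - of_bool (\<bar>i\<bar> \<le> s \<and> s < \<bar>j\<bar>) * (-1) ^ (par j * (par i + 1) + par i) *
      qd * inverse q"

text \<open>From a pair \<open>s, - s\<close> only the values at \<open>(- i, j)\<close> and
  \<open>(j, - i)\<close> arise, and these are proportional by the skew relation. The new potential
  is constant for |i| <= s < |j| and zero elsewhere, so the cases are its two jumps, the stretch
  between them, and the outside.\<close>

lemma form2_less_qs_forms_potential:
  assumes \<nu>: "\<nu> \<in> qs_forms n" and ij: "i \<in> idx n" "j \<in> idx n" "\<bar>i\<bar> < \<bar>j\<bar>" and s: "1 \<le> s" "s \<le> int n"
  shows "form2 n i j \<nu> s (- s) =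
      potential_coeff i j (s - 1) * \<nu> (- i) j - q\<^sup>2 * (potential_coeff i j s * \<nu> (- i) j)"
    "form2 n i j \<nu> (- s) s = q\<^sup>2 * (potential_coeff i j (s - 1) *
        \<nu> (- i) j) - potential_coeff i j s * \<nu> (- i) j"
proof -
  note form = form2_less[OF ij]
  have nz: "i \<noteq> 0" "j \<noteq> 0" using ij idx_nonzero by auto
  have sw: "\<nu> j (- i) = (-1) ^ (par (- i) * par j) * inverse q * \<nu> (- i) j"
    using qs_forms_swap[OF \<nu>, of "- i" j] ij by simp
  consider "s = \<bar>i\<bar>" | "s = \<bar>j\<bar>" | "\<bar>i\<bar> < s" "s < \<bar>j\<bar>" | "s < \<bar>i\<bar> \<or> \<bar>j\<bar> < s"
    by linarith
  then have "form2 n i j \<nu> s (- s) =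
      potential_coeff i j (s - 1) * \<nu> (- i) j - q\<^sup>2 * (potential_coeff i j s * \<nu> (- i) j)
      \<and> form2 n i j \<nu> (- s) s =
          q\<^sup>2 * (potential_coeff i j (s - 1) * \<nu> (- i) j) - potential_coeff i j s * \<nu> (- i) j"
  proof cases
    case 1
    show ?thesis
    proof (cases "i > 0")
      case True
      then have "s = i" "i \<noteq> j" "i \<noteq> - j" using 1 ij by auto
      then show ?thesis using ij True nz
        by (cases "j > 0")
          (auto simp: form sw potential_coeff_def between_def dq_def par_def field_simps
              power2_eq_square)
    next
      case False
      then have "s = - i" "i \<noteq> j" "i \<noteq> - j" "- i \<noteq> j" using 1 ij by auto
      then show ?thesis using ij False nz
        by (cases "j > 0")
          (auto simp: form sw potential_coeff_def between_def dq_def par_def field_simps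
              power2_eq_square)
    qed
  next
    case 2
    show ?thesis
    proof (cases "j > 0")
      case True
      then have "s = j" "i \<noteq> j" "i \<noteq> - j" "- i \<noteq> j" using 2 ij by auto
      then show ?thesis using ij True nz
        by (cases "i > 0")
          (auto simp: form sw potential_coeff_def between_def dq_def par_def field_simps
              power2_eq_square)
    next
      case False
      then have "s = - j" "i \<noteq> j" "i \<noteq> - j" "- i \<noteq> j" using 2 ij by auto
      then show ?thesis using ij False nz
        by (cases "i > 0")
          (auto simp: form sw potential_coeff_def between_def dq_def par_def field_simps
              power2_eq_square)
    qed
  next
    \<comment> \<open>The potential is constant here, and its factor is explained by
      \<open>(1 - q\<^sup>2) * (- (qd * inverse q)) = qd\<^sup>2\<close>.\<close>
    case 3
    then have "s \<noteq> i" "s \<noteq> - i" "- s \<noteq> i" "- s \<noteq> - i" "s \<noteq> j" "s \<noteq> - j" "- s \<noteq> j" "- s \<noteq> - j"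
        "s \<in> between i j" "- s \<in> between i j"
      using s by (auto simp: between_def)
    then show ?thesis using ij nz 3 s
      by (cases "i > 0"; cases "j > 0")
        (auto simp: form sw potential_coeff_def dq_def par_def field_simps power2_eq_square)
  next
    case 4
    then have "s \<noteq> i" "s \<noteq> - i" "- s \<noteq> i" "- s \<noteq> - i" "s \<noteq> j" "s \<noteq> - j" "- s \<noteq> j" "- s \<noteq> - j"
        "s \<notin> between i j" "- s \<notin> between i j" "potential_coeff i j s = 0"
            "potential_coeff i j (s - 1) = 0"
      using s ij by (auto simp: between_def potential_coeff_def)
    then show ?thesis by (simp add: form)
  qed
  then show "form2 n i j \<nu> s (- s) =
      potential_coeff i j (s - 1) * \<nu> (- i) j - q\<^sup>2 * (potential_coeff i j s * \<nu> (- i) j)"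
    "form2 n i j \<nu> (- s) s = q\<^sup>2 * (potential_coeff i j (s - 1) *
        \<nu> (- i) j) - potential_coeff i j s * \<nu> (- i) j"
    by auto
qed

text \<open>At \<open>a = i\<close>, and likewise at \<open>a = - j\<close>, two terms remain; they
  cancel for negative \<open>a\<close> by the skew relation for \<open>\<nu>\<close>.\<close>

lemma form2_less_qs_forms_diag:
  assumes \<nu>: "\<nu> \<in> qs_forms n" and ij: "i \<in> idx n" "j \<in> idx n" "\<bar>i\<bar> < \<bar>j\<bar>" and a: "a \<in> idx n" "a < 0"
  shows "form2 n i j \<nu> a a = 0"
proof -
  note form = form2_less[OF ij]
  have nz: "i \<noteq> 0" "j \<noteq> 0" "i \<noteq> j" "i \<noteq> - j" "- i \<noteq> j" using ij idx_nonzero by auto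
  consider "a = i" | "a = - j" | "a \<noteq> i" "a \<noteq> - j" by blast
  then show ?thesis
  proof cases
    case 1
    then show ?thesis using nz a ij qs_forms_swap[OF \<nu>, of i j]
      by (cases "j > 0") (auto simp: form between_def dq_def par_def)
  next
    case 2
    then show ?thesis using nz a ij qs_forms_swap[OF \<nu>, of "- i" "- j"]
      by (cases "i > 0") (auto simp: form between_def dq_def par_def)
  next
    case 3
    then show ?thesis using a by (simp add: form)
  qed
qed

text \<open>Except at \<open>a = i\<close>, \<open>b = - j\<close>, both sides are multiples of one
  value of \<open>\<nu>\<close>, after at most one use of the skew relation or of the vanishing on
  negative diagonal pairs.\<close>

lemma form2_less_qs_forms_swap:
  assumes \<nu>: "\<nu> \<in> qs_forms n" and ij: "i \<in> idx n" "j \<in> idx n" "\<bar>i\<bar> < \<bar>j\<bar>"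
    and ab: "a \<in> idx n" "b \<in> idx n" "\<bar>a\<bar> < \<bar>b\<bar>"
  shows "form2 n i j \<nu> b a = (-1) ^ (par a * par b) * inverse q * form2 n i j \<nu> a b"
proof -
  note form = form2_less[OF ij]
  note swap = qs_forms_swap[OF \<nu>]
  \<comment> \<open>With \<open>inverse q\<close> as an atom, the identities become polynomial in
    \<open>q\<close> and \<open>p\<close>, reduced by the rules \<open>qp\<close>.\<close>
  obtain p where p: "inverse q = p" by simp
  have qp: "q * p = 1" "q * (p * x) = x" "p * q = 1" "p * (q * x) = x" for x
    by (simp_all flip: p)
  have dq: "dq x y = 1" if "\<bar>y\<bar> \<noteq> \<bar>x\<bar>" for x y using that by (simp add: dq_def)
  have sg: "0 < x \<and> par x = 0 \<and> par (- x) = 1 \<or> \<not> 0 < x \<and> x < 0 \<and> par x = 1 \<and> par (- x) = 0"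
    if "x \<noteq> 0" for x using that by (auto simp: par_def)
  have nz: "i \<noteq> 0" "j \<noteq> 0" "i \<noteq> j" "j \<noteq> i" "i \<noteq> - j" "- j \<noteq> i" "- i \<noteq> j" "a \<noteq> 0" "b \<noteq> 0" "a \<noteq> b"
      "a \<noteq> - b" "- a \<noteq> b" "b \<noteq> a" "b \<noteq> - a"
    using ij ab idx_nonzero by auto
  consider (1) "a = i" "b = j" | (2) "a = i" "b = - j" | (3) "a = - i" "b = - j"
    | (4) "a = i" "b \<in> between i j" | (5) "a = i" "\<bar>j\<bar> < \<bar>b\<bar>" | (6) "b = i"
    | (7) "b = - j" "\<bar>a\<bar> < \<bar>i\<bar>" | (8) "b = - j" "a \<in> between i j" | (9) "a = - j"
    | (10) "a \<noteq> i" "a \<noteq> - j" "b \<noteq> i" "b \<noteq> - j"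
  proof -
    have "x \<in> between i j \<longleftrightarrow> \<bar>i\<bar> < \<bar>x\<bar> \<and> \<bar>x\<bar> < \<bar>j\<bar>" for x by (simp add: between_def)
    moreover have "\<bar>b\<bar> < \<bar>j\<bar> \<or> b = j \<or> b = - j \<or> \<bar>j\<bar> < \<bar>b\<bar>"
      "\<bar>a\<bar> < \<bar>i\<bar> \<or> a = i \<or> a = - i \<or> \<bar>i\<bar> < \<bar>a\<bar>" by linarith+
    moreover have "b = - j \<Longrightarrow> \<bar>a\<bar> < \<bar>j\<bar>" "a = i \<Longrightarrow> \<bar>i\<bar> < \<bar>b\<bar>" using ab(3) by auto
    ultimately show ?thesis using that by blast
  qed
  then show ?thesis
  proof cases
    case 1
    have diag: "j < 0 \<Longrightarrow> \<nu> j j = 0" using qs_forms_diag[OF \<nu> ij(2)] .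
    have c: "i \<notin> between i j" "j \<notin> between i j" "dq i j = 1" "j > 0 \<Longrightarrow> dq j j = q"
      using ij(3) by (auto simp: between_def dq) (auto simp: dq_def)
    have F1: "form2 n i j \<nu> i j = qd * (-1) ^ par i * (dq j j * \<nu> j j)"
      unfolding form using c nz by (simp add: mult.assoc)
    have F2: "form2 n i j \<nu> j i = qd * (-1) ^ par i * ((-1) ^ ((par i + par j) * par j) * \<nu> j j)"
      unfolding form using c nz by (simp add: mult.assoc)
    show ?thesis
      unfolding 1 F1 F2 using sg[OF nz(1)] sg[OF nz(2)]
      by (elim disjE conjE) (simp_all add: diag c(4) p qp algebra_simps power2_eq_square)
  next
    \<comment> \<open>Here the weight-zero values at |i| and |j| enter, together with the sum over
      \<open>between i j\<close>. Expressed through the potential at |i| - 1, |i|, |j| - 1 and |j|,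
      the claim is an identity in four free values.\<close>
    case 2
    obtain r where r:
      "\<And>s. 1 \<le> s \<Longrightarrow> s \<le> int n \<Longrightarrow> \<nu> s (- s) = r (s - 1) - q\<^sup>2 * r s"
      "\<And>s. 1 \<le> s \<Longrightarrow> s \<le> int n \<Longrightarrow> \<nu> (- s) s = q\<^sup>2 * r (s - 1) - r s"
      by (rule qs_forms_potential[OF \<nu>]) blast
    have "1 \<le> \<bar>i\<bar>" "\<bar>i\<bar> \<le> int n" "1 \<le> \<bar>j\<bar>" "\<bar>j\<bar> \<le> int n"
      using ij by (auto simp: idx_def)
    note ri = r[OF this(1,2)] and rj = r[OF this(3,4)]
    obtain r0 r1 r2 r3 where r': "r (\<bar>i\<bar> - 1) = r0" "r \<bar>i\<bar> = r1" "r (\<bar>j\<bar> - 1) = r2" "r \<bar>j\<bar> = r3"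
      by simp
    have sum: "(\<Sum>m\<in>between i j. \<nu> m (- m)) = (1 + q\<^sup>2) * (r1 - r2)"
      using sum_between_qs_forms[of n \<nu> r j i, OF r _ ij(3)] ij(2) r' by (simp add: idx_def)
    have i: "\<nu> i (- i) = (if i > 0 then r0 - q\<^sup>2 * r1 else q\<^sup>2 * r0 - r1)"
        "\<nu> (- i) i = (if i > 0 then q\<^sup>2 * r0 - r1 else r0 - q\<^sup>2 * r1)"
      using ri r' by (auto simp: abs_if split: if_splits)
    have j: "\<nu> j (- j) = (if j > 0 then r2 - q\<^sup>2 * r3 else q\<^sup>2 * r2 - r3)"
        "\<nu> (- j) j = (if j > 0 then q\<^sup>2 * r2 - r3 else r2 - q\<^sup>2 * r3)"
      using rj r' by (auto simp: abs_if split: if_splits)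
    have dq: "dq i (- j) = 1" "dq j i = 1" "dq i i = (if i > 0 then q else inverse q)"
        "dq j (- j) = (if j > 0 then inverse q else q)"
      using ij(3) nz by (auto simp: dq_def)
    have btw: "i \<notin> between i j" "- j \<notin> between i j" by (simp_all add: between_def)
    have ne: "- j \<noteq> i" using nz by auto
    have par_j: "par (- j) = 1 - par j" using nz by (simp add: par_def)
    have F1: "form2 n i j \<nu> i (- j) =
      qd * (-1) ^ par i * (- ((-1) ^ ((par i + par j) * par i) * dq i i * (-1) ^ (par j * (par i +
          1)) * \<nu> i (- i))
        + dq j (- j) * \<nu> j (- j))
      - of_bool (i > 0) * qd\<^sup>2 * (-1) ^ par j * \<nu> (- i) i
      + of_bool (j < 0) * qd\<^sup>2 * (-1) ^ par i * \<nu> (- j) j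
      - qd\<^sup>2 * (-1) ^ par i * (-1) ^ par j * ((1 + q\<^sup>2) * (r1 - r2))"
      unfolding form sum r' using nz ne btw by (simp add: mult.assoc)
    have F2: "form2 n i j \<nu> (- j) i = qd * (-1) ^ par i *
      ((-1) ^ ((par i + par j) * par (- j)) * \<nu> (- j) j - (-1) ^ (par j * (par i + 1)) * \<nu> (- i) i)"
      unfolding form using nz ne btw dq by simp
    have pos: "i > 0 \<or> \<not> i > 0" "j > 0 \<or> \<not> j > 0 \<and> j < 0" using nz by auto
    show ?thesis
      unfolding 2 F1 F2 i j dq par_j p
      using pos by (elim disjE conjE) (simp_all add: par_def algebra_simps power2_eq_square qp)
  next
    case 3
    have diag: "0 < i \<Longrightarrow> \<nu> (- i) (- i) = 0" using qs_forms_diag[OF \<nu>, of "- i"] ij(1) by simp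
    have c: "- i \<notin> between i j" "- j \<notin> between i j" "dq j (- i) = 1" "i < 0 \<Longrightarrow> dq i (- i) = q"
      using ij(3) nz(1) by (auto simp: between_def dq) (auto simp: dq_def)
    have F1: "form2 n i j \<nu> (- i) (- j) =
        - (qd * (-1) ^ par i * ((-1) ^ ((par i + par j) * par (- i)) * (dq i (- i) *
        ((-1) ^ (par j * (par i + 1)) * \<nu> (- i) (- i)))))"
      unfolding form using c nz by (simp add: mult.assoc)
    have F2: "form2 n i j \<nu> (- j) (- i) =
        - (qd * (-1) ^ par i * ((-1) ^ (par j * (par i + 1)) * \<nu> (- i) (- i)))"
      unfolding form using c nz by (simp add: mult.assoc)
    show ?thesis
      unfolding 3 F1 F2 using sg[OF nz(1)] sg[OF nz(2)]
      by (elim disjE conjE) (simp_all add: diag c(4) p qp algebra_simps power2_eq_square)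
  next
    case 4
    have sw: "\<nu> j b = (-1) ^ (par b * par j) * inverse q * \<nu> b j"
      by (rule swap) (use 4 ij ab in \<open>auto simp: between_def\<close>)
    have c: "b \<noteq> i" "b \<noteq> - i" "b \<noteq> j" "b \<noteq> - j" "- b \<noteq> i" "- b \<noteq> j" "i \<notin> between i j"
        "b \<in> between i j" "dq j b = 1" "dq i b = 1"
      using 4 ij ab by (auto simp: between_def dq)
    have F1: "form2 n i j \<nu> i b =
        qd * (-1) ^ par i * \<nu> j b + qd\<^sup>2 * ((-1) ^ par i * ((-1) ^ (par b * par j) * \<nu> b j))"
      unfolding form using c nz by (simp add: mult.assoc)
    have F2: "form2 n i j \<nu> b i = qd * (-1) ^ par i * ((-1) ^ ((par i + par j) * par b) * \<nu> b j)"
      unfolding form using c nz by (simp add: mult.assoc)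
    show ?thesis
      unfolding 4(1) F1 F2 sw using sg[OF nz(1)] sg[OF nz(2)] sg[OF nz(9)]
      by (elim disjE conjE) (simp_all add: p qp algebra_simps power2_eq_square)
  next
    case 5
    have sw: "\<nu> b j = (-1) ^ (par j * par b) * inverse q * \<nu> j b"
      by (rule swap) (use 5 ij ab in \<open>auto simp: between_def\<close>)
    have c: "b \<noteq> i" "b \<noteq> - i" "b \<noteq> j" "b \<noteq> - j" "- b \<noteq> i" "- b \<noteq> j" "i \<notin> between i j"
        "b \<notin> between i j" "dq j b = 1" "dq i b = 1"
      using 5 ij ab by (auto simp: between_def dq)
    have F1: "form2 n i j \<nu> i b = qd * (-1) ^ par i * \<nu> j b"
      unfolding form using c nz by (simp add: mult.assoc)
    have F2: "form2 n i j \<nu> b i = qd * (-1) ^ par i * ((-1) ^ ((par i + par j) * par b) * \<nu> b j)"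
      unfolding form using c nz by (simp add: mult.assoc)
    show ?thesis
      unfolding 5(1) F1 F2 sw using sg[OF nz(1)] sg[OF nz(2)] sg[OF nz(9)]
      by (elim disjE conjE) (simp_all add: p qp algebra_simps power2_eq_square)
  next
    case 6
    have sw: "\<nu> j a = (-1) ^ (par a * par j) * inverse q * \<nu> a j"
      by (rule swap) (use 6 ij ab in \<open>auto simp: between_def\<close>)
    have c: "a \<noteq> i" "a \<noteq> - i" "a \<noteq> j" "a \<noteq> - j" "- a \<noteq> i" "- a \<noteq> j" "i \<notin> between i j"
        "a \<notin> between i j" "dq j a = 1" "dq i a = 1"
      using 6 ij ab by (auto simp: between_def dq)
    have F1: "form2 n i j \<nu> a i = qd * (-1) ^ par i * ((-1) ^ ((par i + par j) * par a) * \<nu> a j)"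
      unfolding form using c nz by (simp add: mult.assoc)
    have F2: "form2 n i j \<nu> i a = qd * (-1) ^ par i * \<nu> j a"
      unfolding form using c nz by (simp add: mult.assoc)
    show ?thesis
      unfolding 6 F1 F2 sw using sg[OF nz(1)] sg[OF nz(2)] sg[OF nz(8)]
      by (elim disjE conjE) (simp_all add: p qp algebra_simps power2_eq_square)
  next
    case 7
    have sw: "\<nu> (- i) a = (-1) ^ (par a * par (- i)) * inverse q * \<nu> a (- i)"
      by (rule swap) (use 7 ij ab in \<open>auto simp: between_def\<close>)
    have c: "a \<noteq> i" "a \<noteq> - i" "a \<noteq> j" "a \<noteq> - j" "- a \<noteq> i" "- a \<noteq> j" "- j \<notin> between i j"
        "a \<notin> between i j" "dq j a = 1" "dq i a = 1"
      using 7 ij ab by (auto simp: between_def dq)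
    have F1: "form2 n i j \<nu> a (- j) =
        - (qd * (-1) ^ par i * ((-1) ^ ((par i + par j) * par a) * ((-1) ^ (par j * (par i + 1)) *
        \<nu> a (- i))))"
      unfolding form using c nz by (simp add: mult.assoc)
    have F2: "form2 n i j \<nu> (- j) a =
        - (qd * (-1) ^ par i * ((-1) ^ (par j * (par i + 1)) * \<nu> (- i) a))"
      unfolding form using c nz by (simp add: mult.assoc)
    show ?thesis
      unfolding 7(1) F1 F2 sw using sg[OF nz(1)] sg[OF nz(2)] sg[OF nz(8)]
      by (elim disjE conjE) (simp_all add: p qp algebra_simps power2_eq_square)
  next
    case 8
    have sw: "\<nu> a (- i) = (-1) ^ (par (- i) * par a) * inverse q * \<nu> (- i) a"
      by (rule swap) (use 8 ij ab in \<open>auto simp: between_def\<close>)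
    have c: "a \<noteq> i" "a \<noteq> - i" "a \<noteq> j" "a \<noteq> - j" "- a \<noteq> i" "- a \<noteq> j" "- j \<notin> between i j"
        "a \<in> between i j" "dq j a = 1" "dq i a = 1"
      using 8 ij ab by (auto simp: between_def dq)
    have F1: "form2 n i j \<nu> a (- j) =
        qd\<^sup>2 * ((-1) ^ par i * ((-1) ^ (par i * par j + 1 + par a + par j + par j * par a) *
        \<nu> (- i) a)) - qd * (-1) ^ par i * ((-1) ^ ((par i + par j) * par a) * ((-1) ^ (par j *
        (par i + 1)) * \<nu> a (- i)))"
      unfolding form using c nz by (simp add: mult.assoc)
    have F2: "form2 n i j \<nu> (- j) a =
        - (qd * (-1) ^ par i * ((-1) ^ (par j * (par i + 1)) * \<nu> (- i) a))"
      unfolding form using c nz by (simp add: mult.assoc)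
    show ?thesis
      unfolding 8(1) F1 F2 sw using sg[OF nz(1)] sg[OF nz(2)] sg[OF nz(8)]
      by (elim disjE conjE) (simp_all add: p qp algebra_simps power2_eq_square)
  next
    case 9
    have sw: "\<nu> b (- i) = (-1) ^ (par (- i) * par b) * inverse q * \<nu> (- i) b"
      by (rule swap) (use 9 ij ab in \<open>auto simp: between_def\<close>)
    have c: "b \<noteq> i" "b \<noteq> - i" "b \<noteq> j" "b \<noteq> - j" "- b \<noteq> i" "- b \<noteq> j" "- j \<notin> between i j"
        "b \<notin> between i j" "dq j b = 1" "dq i b = 1"
      using 9 ij ab by (auto simp: between_def dq)
    have F1: "form2 n i j \<nu> (- j) b =
        - (qd * (-1) ^ par i * ((-1) ^ (par j * (par i + 1)) * \<nu> (- i) b))"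
      unfolding form using c nz by (simp add: mult.assoc)
    have F2: "form2 n i j \<nu> b (- j) =
        - (qd * (-1) ^ par i * ((-1) ^ ((par i + par j) * par b) * ((-1) ^ (par j * (par i + 1)) *
        \<nu> b (- i))))"
      unfolding form using c nz by (simp add: mult.assoc)
    show ?thesis
      unfolding 9 F1 F2 sw using sg[OF nz(1)] sg[OF nz(2)] sg[OF nz(9)]
      by (elim disjE conjE) (simp_all add: p qp algebra_simps power2_eq_square)
  next
    case 10
    then show ?thesis using nz by (simp add: form)
  qed
qed

theorem form2_qs_forms:
  assumes "\<nu> \<in> qs_forms n" "i \<in> idx n" "j \<in> idx n"
  shows "form2 n i j \<nu> \<in> qs_forms n"
proof -
  consider "j = i" | "j = - i" "i > 0" | "j = - i" "i < 0" | "\<bar>i\<bar> < \<bar>j\<bar>" | "\<bar>j\<bar> < \<bar>i\<bar>"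
    using idx_nonzero[OF assms(2)] by linarith
  then show ?thesis
  proof cases
    case 1
    have eq: "form2 n i i \<nu> = (\<lambda>a b. dq i a * dq i b * \<nu> a b)"
      by (intro ext form2_same assms)
    show ?thesis
      unfolding 1 eq
    proof (rule qs_forms_twist[OF assms(1)])
      show "dq i a * dq i (- a) = 1" if "a \<in> idx n" for a
        using idx_nonzero[OF that] by (auto simp: dq_def)
    qed
  next
    case 2
    then show ?thesis using form2_opp_qs_forms assms by simp
  next
    case 3
    then have "form2 n i j \<nu> = (\<lambda>a b. 0)" by (auto intro!: ext form2_opp_neg)
    then show ?thesis by (simp add: qs_forms_zero)
  next
    case 4
    note form2_less_qs_forms_swap[OF assms 4] form2_less_qs_forms_diag[OF assms 4]
      form2_less_qs_forms_potential[OF assms 4]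
    \<comment> \<open>The boundary conditions hold because 1 <= |i| and |j| <= n.\<close>
    moreover have "potential_coeff i j 0 = 0" "potential_coeff i j (int n) = 0"
      using assms(2,3) by (auto simp: potential_coeff_def idx_def)
    ultimately show ?thesis
      by (intro qs_formsI[where r = "\<lambda>s. potential_coeff i j s * \<nu> (- i) j"]) simp_all
  next
    case 5
    then have "form2 n i j \<nu> = (\<lambda>a b. 0)" by (auto intro!: ext form2_gt)
    then show ?thesis by (simp add: qs_forms_zero)
  qed
qed

section \<open>Functionals on tensor powers\<close>

lemma tensor_power_subspace: "scl.subspace (tensor_power n k)"
proof (rule scl.subspaceI)
  show "x + y \<in> tensor_power n k" if "x \<in> tensor_power n k" "y \<in> tensor_power n k" for x y
    using that Poly_Mapping.keys_add[of x y] unfolding tensor_power_def by blast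
  show "c \<cdot> x \<in> tensor_power n k" if "x \<in> tensor_power n k" for c x
    using that by (auto simp: tensor_power_def in_keys_iff)
qed (simp add: tensor_power_def)

lemma tensor_power_mult:
  assumes "x \<in> tensor_power n k" "y \<in> tensor_power n l"
  shows "x * y \<in> tensor_power n (k + l)"
  using assms Poly_Mapping.keys_mult[of x y] unfolding tensor_power_def
  by (fastforce simp: plus_list_def)

lemma single_tensor_power:
  "length w = k \<Longrightarrow> set w \<subseteq> idx n \<Longrightarrow> Poly_Mapping.single w c \<in> tensor_power n k"
  by (simp add: tensor_power_def)

lemma t_vec_tensor_power:
  assumes "i \<in> idx n" "j \<in> idx n"
  shows "t_vec n i j a \<in> tensor_power n (Suc 0)"
proof -
  note sub = tensor_power_subspace[of n "Suc 0"]
  have E: "Emat b c a \<in> tensor_power n (Suc 0)" if "b \<in> idx n" for b c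
    using that by (simp add: Emat_def single_tensor_power scl.subspace_0[OF sub])
  show ?thesis
    unfolding t_vec_def EEmat_def using assms
    by (auto intro!: scl.subspace_sum[OF sub] scl.subspace_scale[OF sub] scl.subspace_diff[OF sub]
        scl.subspace_0[OF sub] E)
qed

lemma t_word_tensor_power:
  assumes "i \<in> idx n" "j \<in> idx n"
  shows "t_word n i j w \<in> tensor_power n (length w)"
  using assms(1)
proof (induction w arbitrary: i)
  case Nil
  then show ?case by (simp add: tensor_power_def zero_list_def of_bool_def)
next
  case (Cons a w)
  note sub = tensor_power_subspace[of n "length (a # w)"]
  have "t_vec n i m a * t_word n m j w \<in> tensor_power n (length (a # w))" if "m \<in> idx n" for m
    using tensor_power_mult[OF t_vec_tensor_power[OF Cons.prems that] Cons.IH[OF that]] by simp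
  then show ?case
    unfolding t_word_Cons[OF assms(2)]
    by (intro scl.subspace_sum[OF sub] scl.subspace_scale[OF sub])
qed

lemma keys_t_word:
  assumes "i \<in> idx n" "j \<in> idx n" "v \<in> Poly_Mapping.keys (t_word n i j w)"
  shows "length v = length w" "set v \<subseteq> idx n"
  using t_word_tensor_power[OF assms(1,2), of w] assms(3) by (auto simp: tensor_power_def)

lemma lin_ext_in_subspace:
  assumes "scl.subspace S" "\<And>w. w \<in> Poly_Mapping.keys v \<Longrightarrow> f w \<in> S"
  shows "lin_ext f v \<in> S"
  unfolding lin_ext_def
  by (intro scl.subspace_sum[OF assms(1)] scl.subspace_scale[OF assms(1)] assms(2))

lemma lin_ext_t_word_tensor_power:
  assumes "i \<in> idx n" "j \<in> idx n" "v \<in> tensor_power n k"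
  shows "lin_ext (t_word n i j) v \<in> tensor_power n k"
proof (rule lin_ext_in_subspace[OF tensor_power_subspace])
  fix w assume "w \<in> Poly_Mapping.keys v"
  then have "length w = k" using assms(3) by (simp add: tensor_power_def)
  then show "t_word n i j w \<in> tensor_power n k" using t_word_tensor_power[OF assms(1,2), of w] by
      simp
qed

lemma t_form_cong:
  assumes "i \<in> idx n" "j \<in> idx n"
    and "\<And>v. length v = length w \<Longrightarrow> set v \<subseteq> idx n \<Longrightarrow> F v = H v"
  shows "t_form n i j F w = t_form n i j H w"
  unfolding t_form_def by (rule pairing_cong) (use assms keys_t_word in blast)

text \<open>Coefficients are values of delta functionals, so they too can be computed through
  \<open>t_form\<close>.\<close>

lemma lookup_eq_pairing: "Poly_Mapping.lookup v w = pairing (\<lambda>u. of_bool (u = w)) v"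
proof -
  have "pairing (\<lambda>u. of_bool (u = w)) v =
      (\<Sum>u\<in>Poly_Mapping.keys v. if u = w then Poly_Mapping.lookup v w else 0)"
    unfolding pairing_def by (rule sum.cong) auto
  also have "\<dots> = Poly_Mapping.lookup v w"
    by (simp add: in_keys_iff)
  finally show ?thesis by simp
qed

section \<open>Triangularity and weights on tensor powers\<close>

text \<open>In every term of the comultiplication |m| < |i| or |j| < |m|, so the first factor
  vanishes on \<open>V\<close> or the second by induction.\<close>

lemma t_form_gt:
  assumes "i \<in> idx n" "j \<in> idx n" "\<bar>j\<bar> < \<bar>i\<bar>" "set w \<subseteq> idx n"
  shows "t_form n i j F w = 0"
  using assms(1,3,4)
proof (induction w arbitrary: i F)
  case Nil
  then show ?case by auto
next
  case (Cons a w)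
  have "vec_form i m a (\<lambda>c. t_form n m j (\<lambda>v. F (c # v)) w) = 0" if "m \<in> idx n" for m
  proof (cases "\<bar>m\<bar> < \<bar>i\<bar>")
    case False
    then have "t_form n m j H w = 0" for H using Cons that by simp
    then show ?thesis by (simp add: vec_form_zero)
  qed (rule vec_form_gt)
  then show ?case using Cons.prems assms(2) by (simp add: t_form_Cons)
qed

text \<open>Beyond triangularity, the term \<open>m = i\<close> vanishes by induction and
  \<open>m = - i\<close> already on its first factor.\<close>

lemma t_form_opp_neg:
  assumes "i \<in> idx n" "i < 0" "set w \<subseteq> idx n"
  shows "t_form n i (- i) F w = 0"
  using assms(3)
proof (induction w arbitrary: F)
  case Nil
  then show ?case using assms by simp
next
  case (Cons a w)
  have "vec_form i m a (\<lambda>c. t_form n m (- i) (\<lambda>v. F (c # v)) w) = 0" if m: "m \<in> idx n" for m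
  proof -
    consider "\<bar>m\<bar> < \<bar>i\<bar>" | "\<bar>i\<bar> < \<bar>m\<bar>" | "m = i" | "m = - i" by linarith
    then show ?thesis
    proof cases
      case 2
      then have "t_form n m (- i) H w = 0" for H
        using t_form_gt[of m n "- i" w H] m assms Cons.prems by simp
      then show ?thesis by (simp add: vec_form_zero)
    next
      case 3
      then show ?thesis using Cons by (simp add: vec_form_zero)
    next
      case 4
      then show ?thesis using assms by (simp add: vec_form_opp)
    qed (rule vec_form_gt)
  qed
  then show ?case using Cons.prems assms by (simp add: t_form_Cons)
qed

definition dq_word :: "int \<Rightarrow> int list \<Rightarrow> Cq" where
  "dq_word i w = prod_list (map (dq i) w)"

lemma dq_word_simps [simp]:
  "dq_word i [] = 1" "dq_word i (a # w) = dq i a * dq_word i w"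
  "dq_word i (u @ w) = dq_word i u * dq_word i w"
  by (simp_all add: dq_word_def)

lemma dq_nonzero [simp]: "dq i a \<noteq> 0"
  by (simp add: dq_def)

lemma dq_word_nonzero [simp]: "dq_word i w \<noteq> 0"
  by (induction w) simp_all

text \<open>Triangularity and \<open>t_form_opp_neg\<close> kill every term but
  \<open>m = i\<close>, so \<open>t\<^sub>i\<^sub>i\<close> acts like a grouplike element.\<close>

lemma t_form_same:
  assumes "i \<in> idx n" "set w \<subseteq> idx n"
  shows "t_form n i i F w = dq_word i w * F w"
  using assms(2)
proof (induction w arbitrary: F)
  case Nil
  then show ?case by simp
next
  case (Cons a w)
  have "sgm i m i (par a) * vec_form i m a (\<lambda>c. t_form n m i (\<lambda>v. F (c # v)) w) =
      (if m = i then dq i a * (dq_word i w * F (a # w)) else 0)" if m: "m \<in> idx n" for m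
  proof -
    consider "\<bar>m\<bar> < \<bar>i\<bar>" | "\<bar>i\<bar> < \<bar>m\<bar>" | "m = i" | "m = - i" "i < 0" | "m = - i" "i > 0"
      using idx_nonzero[OF assms(1)] by linarith
    then show ?thesis
    proof cases
      case 1
      then show ?thesis using vec_form_gt[OF 1] by auto
    next
      case 2
      then have "t_form n m i H w = 0" for H
        using t_form_gt[of m n i w H] m assms Cons.prems by simp
      then show ?thesis using 2 by (auto simp: vec_form_zero)
    next
      case 3
      then show ?thesis using Cons by (simp add: sgm_right vec_form_same)
    next
      case 4
      then show ?thesis by (simp add: vec_form_opp)
    next
      case 5
      then have "t_form n m i H w = 0" for H
        using t_form_opp_neg[of m n w H] m Cons.prems by simp
      then show ?thesis using 5 by (auto simp: vec_form_zero)
    qed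
  qed
  then show ?case using Cons.prems assms by (simp add: t_form_Cons)
qed

lemma lookup_lin_ext_t_word_same:
  assumes "i \<in> idx n" "v \<in> tensor_power n k"
  shows "Poly_Mapping.lookup (lin_ext (t_word n i i) v) w = dq_word i w * Poly_Mapping.lookup v w"
proof -
  have "pairing (t_form n i i (\<lambda>u. of_bool (u = w))) v = pairing (\<lambda>u. dq_word i w * of_bool (u =
      w)) v"
    by (rule pairing_cong) (use assms in \<open>auto simp: t_form_same tensor_power_def\<close>)
  then show ?thesis
    unfolding lookup_eq_pairing pairing_t_word pairing_scale_left .
qed

section \<open>Stability of the functionals on words\<close>

text \<open>The functionals that kill the two-sided ideal generated by the common kernel of
  \<open>qs_forms n\<close>, one condition for each adjacent pair. No length is fixed, so all
  degrees are treated at once.\<close>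

definition qs_funs :: "nat \<Rightarrow> (int list \<Rightarrow> Cq) set" where
  "qs_funs n = {F. \<forall>u v. set u \<subseteq> idx n \<longrightarrow> set v \<subseteq> idx n \<longrightarrow> (\<lambda>a b. F (u @ a # b # v)) \<in> qs_forms n}"

lemma qs_funsD:
  "F \<in> qs_funs n \<Longrightarrow> set u \<subseteq> idx n \<Longrightarrow> set v \<subseteq> idx n \<Longrightarrow> (\<lambda>a b. F (u @ a # b # v)) \<in> qs_forms n"
  by (simp add: qs_funs_def)

lemma qs_funs_Cons:
  assumes "F \<in> qs_funs n" "c \<in> idx n"
  shows "(\<lambda>w. F (c # w)) \<in> qs_funs n"
  unfolding qs_funs_def using qs_funsD[OF assms(1), of "c # _"] assms(2) by simp

lemma qs_forms_cong:
  assumes "\<mu> \<in> qs_forms n" "\<And>a b. a \<in> idx n \<Longrightarrow> b \<in> idx n \<Longrightarrow> \<nu> a b = \<mu> a b"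
  shows "\<nu> \<in> qs_forms n"
proof -
  obtain r where r: "r 0 = 0" "r (int n) = 0"
    "\<And>s. 1 \<le> s \<Longrightarrow> s \<le> int n \<Longrightarrow> \<mu> s (- s) = r (s - 1) - q\<^sup>2 * r s"
    "\<And>s. 1 \<le> s \<Longrightarrow> s \<le> int n \<Longrightarrow> \<mu> (- s) s = q\<^sup>2 * r (s - 1) - r s"
    by (rule qs_forms_potential[OF assms(1)]) blast
  have "s \<in> idx n" "- s \<in> idx n" if "1 \<le> s" "s \<le> int n" for s using that by (auto simp: idx_def)
  then show ?thesis
    by (intro qs_formsI[where r = r])
      (use qs_forms_swap[OF assms(1)] qs_forms_diag[OF assms(1)] in \<open>simp_all add: r assms(2)\<close>)
qed

text \<open>The skew relations compare pairs of equal parity, and all pairs \<open>s, - s\<close>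
  are odd, so the potential is kept or dropped as a whole. The number \<open>e\<close> stands for
  the parity of the letters around the pair.\<close>

lemma qs_forms_parity:
  assumes "\<nu> \<in> qs_forms n"
  shows "(\<lambda>a b. if even (par a + par b + e) then \<nu> a b else 0) \<in> qs_forms n"
proof -
  obtain r where r: "r 0 = 0" "r (int n) = 0"
    "\<And>s. 1 \<le> s \<Longrightarrow> s \<le> int n \<Longrightarrow> \<nu> s (- s) = r (s - 1) - q\<^sup>2 * r s"
    "\<And>s. 1 \<le> s \<Longrightarrow> s \<le> int n \<Longrightarrow> \<nu> (- s) s = q\<^sup>2 * r (s - 1) - r s"
    by (rule qs_forms_potential[OF assms(1)]) blast
  have par: "par s + par (- s) = 1" "par (- s) + par s = 1" if "1 \<le> s" for s
    using that by (auto simp: par_def)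
  show ?thesis
  proof (rule qs_formsI[where r = "\<lambda>s. if even (1 + e) then r s else 0"])
    fix a b assume "a \<in> idx n" "b \<in> idx n" "\<bar>a\<bar> < \<bar>b\<bar>"
    note qs_forms_swap[OF assms this]
    moreover have "par b + par a + e = par a + par b + e" by simp
    ultimately show "(if even (par b + par a + e) then \<nu> b a else 0) =
        (-1) ^ (par a * par b) * inverse q * (if even (par a + par b + e) then \<nu> a b else 0)"
      by (simp only: mult_zero_right if_distrib[of "(*) _"])
  next
    show "(if even (par a + par a + e) then \<nu> a a else 0) = 0" if "a \<in> idx n" "a < 0" for a
      using qs_forms_diag[OF assms that] by simp
    fix s assume s: "1 \<le> s" "s \<le> int n"
    show "(if even (par s + par (- s) + e) then \<nu> s (- s) else 0) =
        (if even (1 + e) then r (s - 1) else 0) - q\<^sup>2 * (if even (1 + e) then r s else 0)"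
      unfolding par(1)[OF s(1)] r(3)[OF s] by simp
    show "(if even (par (- s) + par s + e) then \<nu> (- s) s else 0) =
        q\<^sup>2 * (if even (1 + e) then r (s - 1) else 0) - (if even (1 + e) then r s else 0)"
      unfolding par(2)[OF s(1)] r(4)[OF s] by simp
  qed (simp_all add: r)
qed

text \<open>The sign rule behind coassociativity: peeling off two letters one by one agrees with
  splitting off both as a block.\<close>

lemma sgm_mult:
  "sgm i m j p * sgm m l j p' = sgm i l j (p + p') * sgm i m l p"
proof -
  have "even ((par i + par m) * (par m + par j) + (par m + par j) * p
        + ((par m + par l) * (par l + par j) + (par l + par j) * p')) \<longleftrightarrow>
      even ((par i + par l) * (par l + par j) + (par l + par j) * (p + p')
        + ((par i + par m) * (par m + par l) + (par m + par l) * p))"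
    by (simp only: even_add even_mult_iff) blast
  then show ?thesis
    unfolding sgm_def power_add[symmetric] by (simp only: minus_one_power_iff)
qed

text \<open>Coassociativity, with the first two letters as one block on which \<open>form2\<close>
  acts.\<close>

lemma t_form_Cons_Cons:
  assumes "i \<in> idx n" "j \<in> idx n" "a \<in> idx n" "b \<in> idx n"
  shows "t_form n i j F (a # b # w) =
    (\<Sum>l\<in>idx n. sgm i l j (par a + par b) *
       form2 n i l (\<lambda>c d. t_form n l j (\<lambda>v. F (c # d # v)) w) a b)"
proof -
  have "t_form n i j F (a # b # w) = (\<Sum>m\<in>idx n. \<Sum>l\<in>idx n. sgm i m j (par a) * sgm m l j (par b) *
      vec_form i m a (\<lambda>c. vec_form m l b (\<lambda>d. t_form n l j (\<lambda>v. F (c # d # v)) w)))"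
    by (simp add: t_form_Cons assms vec_form_sum vec_form_scale sum_distrib_left mult.assoc)
  also have "\<dots> = (\<Sum>l\<in>idx n. \<Sum>m\<in>idx n. sgm i m j (par a) * sgm m l j (par b) *
      vec_form i m a (\<lambda>c. vec_form m l b (\<lambda>d. t_form n l j (\<lambda>v. F (c # d # v)) w)))"
    by (rule sum.swap)
  finally show ?thesis
    unfolding sgm_mult form2_def by (simp add: sum_distrib_left mult.assoc)
qed

text \<open>Induction on the letters before the pair reduces to a pair at the front, where
  \<open>form2_qs_forms\<close> applies.\<close>

theorem t_form_qs_funs:
  assumes "F \<in> qs_funs n" "i \<in> idx n" "j \<in> idx n"
  shows "t_form n i j F \<in> qs_funs n"
proof -
  have "(\<lambda>a b. t_form n i j F (u @ a # b # v)) \<in> qs_forms n"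
    if "set u \<subseteq> idx n" "set v \<subseteq> idx n" for u v
    using that(1) assms(1,2)
  proof (induction u arbitrary: F i)
    case Nil
    let ?N = "\<lambda>l c d. t_form n l j (\<lambda>w. F (c # d # w)) v"
    \<comment> \<open>A finite combination of the forms of \<open>F\<close> at the first two places,
      one for each word occurring in the image of \<open>v\<close>.\<close>
    have N: "?N l \<in> qs_forms n" if "l \<in> idx n" for l
      unfolding t_form_def pairing_def
      by (intro qs_forms_sum qs_forms_scale)
        (use qs_funsD[OF Nil(2), of "[]"] keys_t_word(2)[OF that assms(3)] in force)
    have "(\<lambda>a b. sgm i l j (par a + par b) * form2 n i l (?N l) a b) \<in> qs_forms n"
      if l: "l \<in> idx n" for l
    proof -
      \<comment> \<open>Up to a constant the sign is a product of factors of the two letters, and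
        \<open>?\<phi> a * ?\<phi> (- a)\<close> is constant because exactly one of
        \<open>a\<close>, \<open>- a\<close> is odd. So \<open>qs_forms_twist\<close> absorbs
        it.\<close>
      let ?\<phi> = "\<lambda>a. (-1) ^ ((par l + par j) * par a) :: Cq"
      have \<phi>: "?\<phi> a * ?\<phi> (- a) = (-1) ^ (par l + par j)" if "a \<in> idx n" for a
        using idx_nonzero[OF that] by (auto simp: par_def)
      have sgm: "sgm i l j (par a + par b) =
          (-1) ^ ((par i + par l) * (par l + par j)) * (?\<phi> a * ?\<phi> b)" for a b
        by (simp only: sgm_def distrib_left[of "par l + par j" "par a" "par b"] power_add)
      have "(\<lambda>a b. (-1) ^ ((par i + par l) * (par l + par j)) *
          (?\<phi> a * ?\<phi> b * form2 n i l (?N l) a b)) \<in> qs_forms n"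
        by (intro qs_forms_scale qs_forms_twist[where \<phi> = ?\<phi>, OF _ \<phi>] form2_qs_forms N l Nil(3))
      then show ?thesis by (simp only: sgm mult.assoc)
    qed
    then have "(\<lambda>a b. \<Sum>l\<in>idx n. sgm i l j (par a + par b) * form2 n i l (?N l) a b) \<in> qs_forms n"
      by (rule qs_forms_sum)
    then show ?case
      by (rule qs_forms_cong) (simp add: t_form_Cons_Cons Nil assms)
  next
    case (Cons x u)
    let ?G = "\<lambda>m c a b. t_form n m j (\<lambda>w. F (c # w)) (u @ a # b # v)"
    have G: "?G m c \<in> qs_forms n" if "m \<in> idx n" "c \<in> idx n" for m c
      using Cons.IH[OF _ qs_funs_Cons[OF Cons.prems(2) that(2)] that(1)] Cons.prems(1) by simp
    have "(\<lambda>a b. vec_form i m x (\<lambda>c. ?G m c a b)) \<in> qs_forms n" if "m \<in> idx n" for m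
    proof -
      \<comment> \<open>In each case \<open>vec_form\<close> is a combination of at most two values
        of its functional.\<close>
      have *: "(\<lambda>a b. y * (k * ?G m c a b + k' * ?G m c' a b)) \<in> qs_forms n"
        if "c \<in> idx n" "c' \<in> idx n" for y k k' c c'
        by (intro qs_forms_scale qs_forms_add G \<open>m \<in> idx n\<close> that)
      have x: "x \<in> idx n" using Cons.prems by simp
      consider "m = i" | "m \<noteq> i" "m = - i" | "m \<noteq> i" "m \<noteq> - i" "\<bar>i\<bar> < \<bar>m\<bar>"
        | "m \<noteq> i" "m \<noteq> - i" "\<not> \<bar>i\<bar> < \<bar>m\<bar>" by blast
      then show ?thesis
      proof cases
        case 1
        then show ?thesis unfolding vec_form_def
          using qs_forms_scale[OF G[OF that x]] by simp
      next
        case 2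
        then show ?thesis unfolding vec_form_def
          using *[of "- i" "- i" 1 "of_bool (0 < i \<and> x = i) * qd" 0] Cons.prems by simp
      next
        case 3
        then show ?thesis unfolding vec_form_def
          using *[of m "- i" "qd * (- 1) ^ par i" "of_bool (x = i)"
              "- ((-1) ^ (par m * (par i + 1)) * of_bool (x = - m))"] Cons.prems that by simp
      next
        case 4
        then show ?thesis unfolding vec_form_def by (simp add: qs_forms_zero)
      qed
    qed
    then have "(\<lambda>a b. \<Sum>m\<in>idx n. sgm i m j (par x) * vec_form i m x (\<lambda>c. ?G m c a b)) \<in> qs_forms n"
      by (intro qs_forms_sum qs_forms_scale)
    then show ?case
      using Cons.prems assms(3) by (simp add: t_form_Cons)
  qed
  then show ?thesis by (simp add: qs_funs_def)
qed

section \<open>Submodules\<close>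

text \<open>All representatives of an element of \<open>Uqp n\<close> lie in the free algebra, hence
  are combinations of words in the generators.\<close>

lemma submodule_VkI:
  assumes "N \<subseteq> tensor_power n k" "scl.subspace N" "\<And>v. v \<in> N \<Longrightarrow> even_part v \<in> N"
    and gen: "\<And>g v. g \<in> gens n \<Longrightarrow> v \<in> N \<Longrightarrow> gen_act n k g v \<in> N"
  shows "submodule_Vk n k N"
  unfolding submodule_Vk_def
proof (intro conjI ballI)
  interpret R: ring "free_alg n" by (rule ring_free_alg)
  interpret I: ideal "Idl\<^bsub>free_alg n\<^esub> (relators n)" "free_alg n"
    by (rule R.genideal_ideal[OF relators_subset])
  fix X x v assume X: "X \<in> carrier (Uqp n)" "x \<in> X" and v: "v \<in> N"
  have "x \<in> carrier (free_alg n)"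
    using X I.a_rcosets_carrier unfolding Uqp_def FactRing_def by auto
  then have keys: "Poly_Mapping.keys x \<subseteq> lists (gens n)" by (simp add: free_alg_def)
  have "foldr (gen_act n k) w v \<in> N" if "set w \<subseteq> gens n" for w
    using that by (induction w) (auto simp: v gen)
  then show "act n k x v \<in> N"
    unfolding act_def by (intro lin_ext_in_subspace assms(2))
        (use keys in \<open>auto simp: in_lists_conv_set\<close>)
qed (use assms in auto)

text \<open>The one-letter word of \<open>g\<close> represents its own coset, and it acts exactly as
  \<open>gen_act\<close>.\<close>

lemma submodule_Vk_gen_act:
  assumes "submodule_Vk n k N" "g \<in> gens n" "v \<in> N"
  shows "gen_act n k g v \<in> N"
proof -
  interpret R: ring "free_alg n" by (rule ring_free_alg)
  let ?I = "Idl\<^bsub>free_alg n\<^esub> (relators n)"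
  interpret I: ideal ?I "free_alg n"
    by (rule R.genideal_ideal[OF relators_subset])
  define x :: "gen list \<Rightarrow>\<^sub>0 Cq" where "x = Poly_Mapping.single [g] 1"
  have x: "x \<in> carrier (free_alg n)" using assms(2) by (simp add: x_def free_alg_def)
  then have "?I +>\<^bsub>free_alg n\<^esub> x \<in> carrier (Uqp n)"
    unfolding Uqp_def FactRing_def by (simp add: R.a_rcosetsI[OF I.a_subset])
  moreover have "x \<in> ?I +>\<^bsub>free_alg n\<^esub> x" by (rule I.a_rcos_self[OF x])
  ultimately have "act n k x v \<in> N"
    using assms(1,3) unfolding submodule_Vk_def by blast
  moreover have "act n k x v = gen_act n k g v"
    by (simp add: act_def lin_ext_def x_def)
  ultimately show ?thesis by simp
qed

lemma submodule_Vk_T: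
  assumes "submodule_Vk n k N" "i \<in> idx n" "j \<in> idx n" "\<bar>i\<bar> \<le> \<bar>j\<bar>" "v \<in> N"
  shows "lin_ext (t_word n i j) v \<in> N"
  using submodule_Vk_gen_act[OF assms(1), of "T i j" v] assms by (simp add: gen_act_def gens_def)

lemma submodule_Vk_Int:
  "submodule_Vk n k M \<Longrightarrow> submodule_Vk n k N \<Longrightarrow> submodule_Vk n k (M \<inter> N)"
  unfolding submodule_Vk_def by (auto intro: scl.subspace_inter)

section \<open>The submodule annihilated by the functionals\<close>

definition qs_kernel :: "nat \<Rightarrow> nat \<Rightarrow> (int list \<Rightarrow>\<^sub>0 Cq) set" where
  "qs_kernel n k = {v \<in> tensor_power n k. \<forall>F\<in>qs_funs n. pairing F v = 0}"

lemma pairing_even_part: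
  "pairing F (even_part v) = pairing (\<lambda>w. if even (\<Sum>a\<leftarrow>w. par a) then F w else 0) v"
  unfolding even_part_def pairing_lin_ext by (rule pairing_cong) simp

lemma qs_funs_parity:
  assumes "F \<in> qs_funs n"
  shows "(\<lambda>w. if even (\<Sum>a\<leftarrow>w. par a) then F w else 0) \<in> qs_funs n"
  unfolding qs_funs_def
proof (intro CollectI allI impI)
  fix u v assume "set u \<subseteq> idx n" "set v \<subseteq> idx n"
  from qs_forms_parity[OF qs_funsD[OF assms this], of "(\<Sum>a\<leftarrow>u @ v. par a)"]
  show "(\<lambda>a b. if even (\<Sum>a\<leftarrow>u @ a # b # v. par a) then F (u @ a # b # v) else 0) \<in> qs_forms n"
    by (simp add: add_ac)
qed

text \<open>Dividing by the weight inverts the right action of \<open>t\<^sub>i\<^sub>i\<close>; it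
  respects the conditions since the eigenvalues at \<open>a\<close> and \<open>- a\<close> are
  inverse to each other.\<close>

lemma qs_funs_dq_word:
  assumes "F \<in> qs_funs n"
  shows "(\<lambda>w. F w / dq_word i w) \<in> qs_funs n"
  unfolding qs_funs_def
proof (intro CollectI allI impI)
  fix u v assume uv: "set u \<subseteq> idx n" "set v \<subseteq> idx n"
  have \<phi>: "inverse (dq i a) * inverse (dq i (- a)) = 1" if "a \<in> idx n" for a
    using idx_nonzero[OF that] by (auto simp: dq_def)
  have "(\<lambda>a b. inverse (dq_word i u) * inverse (dq_word i v) *
      (inverse (dq i a) * inverse (dq i b) * F (u @ a # b # v))) \<in> qs_forms n"
    by (intro qs_forms_scale qs_funsD[OF assms uv]
        qs_forms_twist[where \<phi> = "\<lambda>a. inverse (dq i a)", OF _ \<phi>])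
  then show "(\<lambda>a b. F (u @ a # b # v) / dq_word i (u @ a # b # v)) \<in> qs_forms n"
    by (simp add: divide_inverse mult_ac)
qed

text \<open>\<open>inv_into\<close> yields a preimage as soon as one exists; dividing each
  coefficient by its eigenvalue exhibits one.\<close>

lemma Tinv_act:
  assumes "i \<in> idx n" "v \<in> tensor_power n k"
  shows "gen_act n k (Tinv i) v \<in> tensor_power n k"
    "lin_ext (t_word n i i) (gen_act n k (Tinv i) v) = v"
proof -
  let ?t = "lin_ext (t_word n i i)"
  define v' where "v' = lin_ext (\<lambda>w. Poly_Mapping.single w (inverse (dq_word i w))) v"
  have v': "v' \<in> tensor_power n k"
    unfolding v'_def
    by (rule lin_ext_in_subspace[OF tensor_power_subspace])
      (use assms(2) in \<open>simp add: tensor_power_def\<close>)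
  have "Poly_Mapping.lookup v' w = inverse (dq_word i w) * Poly_Mapping.lookup v w" for w
  proof -
    have "pairing (\<lambda>u. inverse (dq_word i u) * of_bool (u = w)) v =
        pairing (\<lambda>u. inverse (dq_word i w) * of_bool (u = w)) v"
      by (rule pairing_cong) auto
    then show ?thesis
      unfolding v'_def lookup_eq_pairing pairing_lin_ext pairing_single pairing_scale_left .
  qed
  then have "?t v' = v"
    by (intro poly_mapping_eqI) (simp add: lookup_lin_ext_t_word_same[OF assms(1) v'])
  then have "v \<in> ?t ` tensor_power n k" using v' by blast
  then show "gen_act n k (Tinv i) v \<in> tensor_power n k" "?t (gen_act n k (Tinv i) v) = v"
    by (simp_all add: gen_act_def inv_into_into f_inv_into_f)
qed

text \<open>Stability of the annihilator is dual to stability of \<open>qs_funs n\<close> under the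
  transposed operators.\<close>

lemma submodule_qs_kernel: "submodule_Vk n k (qs_kernel n k)"
proof (rule submodule_VkI)
  show "qs_kernel n k \<subseteq> tensor_power n k" by (auto simp: qs_kernel_def)
  show "scl.subspace (qs_kernel n k)"
    by (rule scl.subspaceI)
      (auto simp: qs_kernel_def pairing_add intro: scl.subspace_0 scl.subspace_add
          scl.subspace_scale tensor_power_subspace)
  fix v assume v: "v \<in> qs_kernel n k"
  have "even_part v \<in> tensor_power n k"
    unfolding even_part_def
    by (rule lin_ext_in_subspace[OF tensor_power_subspace])
      (use v in \<open>auto simp: qs_kernel_def tensor_power_def\<close>)
  then show "even_part v \<in> qs_kernel n k"
    using v qs_funs_parity by (auto simp: qs_kernel_def pairing_even_part)
  fix g assume "g \<in> gens n"
  then consider i j where "g = T i j" "i \<in> idx n" "j \<in> idx n" | i where "g = Tinv i" "i \<in> idx n"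
    by (auto simp: gens_def)
  then show "gen_act n k g v \<in> qs_kernel n k"
  proof cases
    case 1
    have "pairing F (lin_ext (t_word n i j) v) = 0" if "F \<in> qs_funs n" for F
      using v t_form_qs_funs[OF that 1(2,3)] unfolding pairing_t_word by (simp add: qs_kernel_def)
    then show ?thesis
      using v lin_ext_t_word_tensor_power[OF 1(2,3)] unfolding qs_kernel_def 1
      by (simp add: gen_act_def del: pairing_lin_ext)
  next
    case 2
    have v': "v \<in> tensor_power n k" using v by (simp add: qs_kernel_def)
    let ?v = "gen_act n k (Tinv i) v"
    note inv = Tinv_act[OF 2(2) v']
    have "pairing F ?v = 0" if "F \<in> qs_funs n" for F
    proof -
      \<comment> \<open>\<open>F\<close> is the image under \<open>t\<^sub>i\<^sub>i\<close> of the
        divided functional, so the inverse can be moved across the pairing.\<close>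
      have "pairing F ?v = pairing (t_form n i i (\<lambda>w. F w / dq_word i w)) ?v"
        by (rule pairing_cong) (use inv(1) 2(2) in \<open>simp add: tensor_power_def t_form_same\<close>)
      also have "\<dots> = pairing (\<lambda>w. F w / dq_word i w) v"
        unfolding pairing_t_word[symmetric] inv(2) ..
      also have "\<dots> = 0"
        using v qs_funs_dq_word[OF that] by (simp add: qs_kernel_def)
      finally show ?thesis .
    qed
    then show ?thesis using inv(1) by (simp add: qs_kernel_def 2)
  qed
qed

section \<open>The top weight space and the criterion for failure of complete reducibility\<close>

text \<open>Powers of the indeterminate are monomials, and a monomial equal to 1 has degree
  0.\<close>

lemma q_power_eq_one_iff: "q ^ m = 1 \<longleftrightarrow> m = 0"
proof
  assume "q ^ m = 1"
  moreover have "q ^ m = Fract (monom 1 m) 1"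
    by (induction m) (simp_all add: q_def One_fract_def mult_monom monom_altdef one_pCons)
  ultimately have "monom (1 :: complex) m = 1"
    by (simp add: One_fract_def eq_fract)
  then show "m = 0"
    using degree_monom_eq[of "1 :: complex" m] by simp
qed simp

text \<open>The top eigenvalue of \<open>t\<^sub>1\<^sub>1\<close> has multiplicity one on words of
  a given length.\<close>

lemma dq_word_max:
  assumes "set w \<subseteq> idx n" "dq_word 1 w = q ^ length w"
  shows "w = replicate (length w) 1"
proof -
  \<comment> \<open>The exponent \<open>m\<close> measures the deficit: a letter \<open>- 1\<close>
    costs two powers of \<open>q\<close>, a letter of absolute value other than 1 costs one, and the
    letter 1 none.\<close>
  have "\<exists>m. dq_word 1 w * q ^ m = q ^ length w \<and> (m = 0 \<longrightarrow> w = replicate (length w) 1)"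
    using assms(1)
  proof (induction w)
    case Nil
    then show ?case by (intro exI[of _ 0]) simp
  next
    case (Cons a w)
    then obtain m where m: "dq_word 1 w * q ^ m = q ^ length w" "m = 0 \<longrightarrow> w = replicate (length w) 1"
      by auto
    consider "a = 1" | "a = - 1" | "\<bar>a\<bar> \<noteq> 1" by linarith
    then show ?case
    proof cases
      case 1
      then show ?thesis using m by (intro exI[of _ m]) (auto simp: dq_def mult.assoc)
    next
      case 2
      have "dq_word 1 (a # w) * q ^ Suc (Suc m) = inverse q * q * q * (dq_word 1 w * q ^ m)"
        unfolding 2 by (simp add: dq_def mult.left_commute)
      then show ?thesis using m by (intro exI[of _ "Suc (Suc m)"]) simp
    next
      case 3
      then show ?thesis using m
        by (intro exI[of _ "Suc m"]) (simp add: dq_def mult.left_commute)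
    qed
  qed
  then obtain m where "dq_word 1 w * q ^ m = q ^ length w" "m = 0 \<longrightarrow> w = replicate (length w) 1"
    by blast
  then show ?thesis using assms(2) q_power_eq_one_iff[of m] by simp
qed

text \<open>Applying \<open>t\<^sub>1\<^sub>1 - c\<close> for all other eigenvalues \<open>c\<close> isolates the one-dimensional top weight space.\<close>

lemma submodule_Vk_top_word:
  assumes "submodule_Vk n k N" "n \<ge> 1" "v \<in> N" "Poly_Mapping.lookup v (replicate k 1) \<noteq> 0"
  shows "Poly_Mapping.single (replicate k 1) 1 \<in> N"
proof -
  let ?x = "replicate k (1 :: int)"
  have one: "1 \<in> idx n" using assms(2) by (simp add: idx_def)
  have sub: "scl.subspace N" and N: "N \<subseteq> tensor_power n k"
    using assms(1) by (auto simp: submodule_Vk_def)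
  have eig: "\<exists>v'\<in>N. \<forall>w. Poly_Mapping.lookup v' w =
      (\<Prod>c\<in>E. dq_word 1 w - c) * Poly_Mapping.lookup v w"
    if "finite E" for E
    using that
  proof induction
    case empty
    then show ?case using assms(3) by auto
  next
    case (insert c E)
    then obtain v' where v': "v' \<in> N"
      "\<And>w. Poly_Mapping.lookup v' w = (\<Prod>c\<in>E. dq_word 1 w - c) * Poly_Mapping.lookup v w"
      by blast
    let ?v = "lin_ext (t_word n 1 1) v' - c \<cdot> v'"
    have "?v \<in> N"
      using submodule_Vk_T[OF assms(1) one one _ v'(1)] v'(1)
      by (intro scl.subspace_diff[OF sub] scl.subspace_scale[OF sub]) simp_all
    moreover have "Poly_Mapping.lookup ?v w =
        (\<Prod>c\<in>insert c E. dq_word 1 w - c) * Poly_Mapping.lookup v w" for w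
      using insert(1,2) N v'(1)
      by (simp add: lookup_minus lookup_lin_ext_t_word_same[OF one subsetD[OF N v'(1)]] v'(2)
          algebra_simps)
    ultimately show ?case by blast
  qed
  let ?E = "dq_word 1 ` (Poly_Mapping.keys v - {?x})"
  obtain v' where v': "v' \<in> N"
    "\<And>w. Poly_Mapping.lookup v' w = (\<Prod>c\<in>?E. dq_word 1 w - c) * Poly_Mapping.lookup v w"
    using eig[of ?E] by auto
  have zero: "Poly_Mapping.lookup v' w = 0" if "w \<noteq> ?x" for w
  proof (cases "w \<in> Poly_Mapping.keys v")
    case True
    then have "dq_word 1 w \<in> ?E" using that by blast
    then have "(\<Prod>c\<in>?E. dq_word 1 w - c) = 0" by (intro prod_zero) auto
    then show ?thesis by (simp add: v'(2))
  qed (simp add: v'(2) in_keys_iff)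
  have top: "dq_word 1 (replicate k 1) = q ^ k" for k
    by (induction k) (simp_all add: dq_def)
  have "(\<Prod>c\<in>?E. dq_word 1 ?x - c) \<noteq> 0"
  proof
    assume "(\<Prod>c\<in>?E. dq_word 1 ?x - c) = 0"
    then have "dq_word 1 ?x \<in> ?E" by (simp add: image_iff)
    then obtain w where "dq_word 1 ?x = dq_word 1 w" "w \<in> Poly_Mapping.keys v - {?x}"
      by (rule imageE)
    then have w: "w \<in> Poly_Mapping.keys v" "w \<noteq> ?x" "dq_word 1 w = dq_word 1 ?x" by auto
    then have "length w = k" "set w \<subseteq> idx n"
      using assms(3) N by (auto simp: tensor_power_def)
    then show False using dq_word_max[of w n] w top[of k] by simp
  qed
  then have nz: "Poly_Mapping.lookup v' ?x \<noteq> 0" using v'(2) assms(4) by simp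
  have "Poly_Mapping.single ?x 1 = inverse (Poly_Mapping.lookup v' ?x) \<cdot> v'"
    by (rule poly_mapping_eqI) (use zero nz in \<open>auto simp: lookup_single when_def\<close>)
  then show ?thesis using scl.subspace_scale[OF sub v'(1)] by simp
qed

lemma not_completely_reducible_VkI:
  assumes "n \<ge> 1" "submodule_Vk n k J"
    and J: "\<And>v. v \<in> J \<Longrightarrow> Poly_Mapping.lookup v (replicate k 1) = 0"
    and gen: "\<And>N. submodule_Vk n k N \<Longrightarrow> Poly_Mapping.single (replicate k 1) 1 \<in> N \<Longrightarrow> N \<inter> J \<noteq> {0}"
  shows "\<not> completely_reducible_Vk n k"
proof
  let ?x = "Poly_Mapping.single (replicate k (1 :: int)) (1 :: Cq)"
  assume "completely_reducible_Vk n k"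
  then obtain \<S> where S: "\<forall>N\<in>\<S>. irreducible_Vk n k N" "scl.span (\<Union>\<S>) = tensor_power n k"
    unfolding completely_reducible_Vk_def by (elim exE conjE)
  \<comment> \<open>Otherwise the span of the summands would lie in the proper subspace where the
    coefficient of the top word vanishes.\<close>
  have "\<exists>N\<in>\<S>. \<exists>v\<in>N. Poly_Mapping.lookup v (replicate k 1) \<noteq> 0"
  proof (rule ccontr)
    assume "\<not> ?thesis"
    then have "\<Union>\<S> \<subseteq> {v. Poly_Mapping.lookup v (replicate k 1) = 0}" by blast
    moreover have "scl.subspace {v :: int list \<Rightarrow>\<^sub>0 Cq. Poly_Mapping.lookup v (replicate k 1) = 0}"
      by (rule scl.subspaceI) (simp_all add: lookup_add)
    ultimately have "tensor_power n k \<subseteq> {v. Poly_Mapping.lookup v (replicate k 1) = 0}"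
      unfolding S(2)[symmetric] by (rule scl.span_minimal)
    moreover have "?x \<in> tensor_power n k"
      using assms(1) by (auto simp: idx_def intro!: single_tensor_power)
    ultimately show False by auto
  qed
  then obtain N v where N: "irreducible_Vk n k N" "v \<in> N"
      "Poly_Mapping.lookup v (replicate k 1) \<noteq> 0"
    using S(1) by blast
  then have sub: "submodule_Vk n k N" by (simp add: irreducible_Vk_def)
  have x: "?x \<in> N" by (rule submodule_Vk_top_word[OF sub assms(1) N(2,3)])
  have "N \<inter> J = {0} \<or> N \<inter> J = N"
    using N(1) submodule_Vk_Int[OF sub assms(2)] unfolding irreducible_Vk_def by blast
  then have "?x \<in> J" using gen[OF sub x] x by blast
  then show False using J[of ?x] by simp
qed

section \<open>The top weight vector\<close>

lemma qd_nonzero: "qd \<noteq> 0"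
proof
  assume "qd = 0"
  then have "q * q = q * inverse q" by simp
  then show False using q_power_eq_one_iff[of 2] by (simp add: power2_eq_square)
qed

lemma set_replicate_one: "n \<ge> 1 \<Longrightarrow> set (replicate k 1) \<subseteq> idx n"
  by (auto simp: idx_def)

text \<open>Each resulting form is supported at most at \<open>(1, 1)\<close>, a pair constrained by
  none of the conditions. Hence the top word does not occur in vectors of
  \<open>qs_kernel n k\<close>.\<close>

lemma delta_qs_funs: "(\<lambda>w. of_bool (w = replicate k 1)) \<in> qs_funs n"
  unfolding qs_funs_def
proof (intro CollectI allI impI)
  fix u v :: "int list"
  have one: "a = 1 \<and> b = 1" if "u @ a # b # v = replicate k 1" for a b
  proof -
    have "set (u @ a # b # v) \<subseteq> {1}" unfolding that by auto
    then show ?thesis by simp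
  qed
  show "(\<lambda>a b. of_bool (u @ a # b # v = replicate k 1)) \<in> qs_forms n"
    by (rule qs_formsI[where r = "\<lambda>_. 0"]) (use one in \<open>force simp: of_bool_def\<close>)+
qed

text \<open>On the letter 1 with \<open>m\<close> other than 1, only \<open>l = m\<close>
  contributes: for |m| < |l| the matrix units need the letter \<open>m\<close> or
  \<open>- l\<close>, and \<open>l = - 1\<close> would force \<open>m = 0\<close>.\<close>

lemma t_form_ones_neq:
  assumes "m \<in> idx n" "j \<in> idx n" "m \<noteq> 1"
  shows "t_form n m j F (replicate k 1) =
    of_bool (m = j) * (if m = - 1 then q ^ k else 1) * F (replicate k 1)"
proof (induction k arbitrary: F)
  case 0
  then show ?case by simp
next
  case (Suc k)
  have one: "1 \<in> idx n" using assms by (auto simp: idx_def)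
  have nz: "m \<noteq> 0" using idx_nonzero assms by blast
  have "sgm m l j (par 1) * vec_form m l 1 (\<lambda>c. t_form n l j (\<lambda>v. F (c # v)) (replicate k 1)) =
      (if l = m then dq m 1 * t_form n m j (\<lambda>v. F (1 # v)) (replicate k 1) else 0)"
    if "l \<in> idx n" for l
  proof -
    consider "l = m" | "l \<noteq> m" "l = - m" | "l \<noteq> m" "l \<noteq> - m" "\<bar>m\<bar> < \<bar>l\<bar>" | "\<bar>l\<bar> < \<bar>m\<bar>"
      by linarith
    then show ?thesis
    proof cases
      case 1
      then show ?thesis by (simp add: vec_form_same sgm_left par_def)
    next
      case 2
      then show ?thesis using nz assms(3) by (simp add: vec_form_opp)
    next
      case 3
      then have "1 \<noteq> - l" using nz by auto
      with 3 show ?thesis using assms(3) by (simp add: vec_form_less)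
    next
      case 4
      then show ?thesis using vec_form_gt[OF 4] by auto
    qed
  qed
  then have "t_form n m j F (replicate (Suc k) 1) =
      dq m 1 * t_form n m j (\<lambda>v. F (1 # v)) (replicate k 1)"
    using assms one by (simp add: t_form_Cons)
  moreover have "dq m 1 = (if m = - 1 then q else 1)"
    using assms(3) by (auto simp: dq_def)
  ultimately show ?case by (simp add: Suc)
qed

text \<open>The case \<open>m = - 1\<close> comes from a separate clause of the action but has the
  same coefficient.\<close>

lemma vec_form_one:
  assumes "m \<in> idx n"
  shows "vec_form 1 m 1 h = (if m = 1 then q * h 1 else qd * h m)"
proof -
  consider "m = 1" | "m = - 1" | "m \<noteq> 1" "m \<noteq> - 1" "\<bar>1\<bar> < \<bar>m\<bar>"
    using idx_nonzero[OF assms] by linarith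
  then show ?thesis
    by cases (auto simp: vec_form_def dq_def par_def)
qed

text \<open>The first letter stays 1 with factor \<open>q\<close> or becomes some \<open>m\<close>
  with factor \<open>qd\<close>; in the second case \<open>t_form_ones_neq\<close> forces
  \<open>m = j\<close>.\<close>

lemma t_form_one_ones_Suc:
  assumes "n \<ge> 1" "j \<in> idx n" "j \<noteq> 1"
  shows "t_form n 1 j F (replicate (Suc k) 1) =
    q * t_form n 1 j (\<lambda>w. F (1 # w)) (replicate k 1)
      + qd * (if j = - 1 then q ^ k else 1) * F (j # replicate k 1)"
proof -
  have one: "1 \<in> idx n" using assms(1) by (simp add: idx_def)
  let ?w = "replicate k (1 :: int)"
  have "t_form n 1 j F (1 # ?w) =
      (\<Sum>m\<in>idx n. (if m = 1 then q * t_form n 1 j (\<lambda>w. F (1 # w)) ?w else 0)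
      + (if m = j then qd * (if j = - 1 then q ^ k else 1) * F (j # ?w) else 0))"
    unfolding t_form_Cons[OF one assms(2) one]
  proof (rule sum.cong[OF refl])
    fix m assume m: "m \<in> idx n"
    show "sgm 1 m j (par 1) * vec_form 1 m 1 (\<lambda>c. t_form n m j (\<lambda>v. F (c # v)) ?w) =
        (if m = 1 then q * t_form n 1 j (\<lambda>w. F (1 # w)) ?w else 0)
        + (if m = j then qd * (if j = - 1 then q ^ k else 1) * F (j # ?w) else 0)"
      unfolding vec_form_one[OF m]
      using t_form_ones_neq[OF m assms(2)] assms(3)
      by (auto simp: sgm_def par_def)
  qed
  then show ?thesis using one assms(2) by (simp add: sum.distrib)
qed

text \<open>The letter \<open>- j\<close> is kept with eigenvalue 1, or is sent to
  \<open>- 1\<close> by the second matrix unit of \<open>t\<^sub>1\<^sub>j\<close>; then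
  \<open>t\<^sub>j\<^sub>j\<close> fixes the remaining letters 1.\<close>

lemma t_form_one_opp:
  assumes "n \<ge> 1" "j \<in> idx n" "j > 1"
  shows "t_form n 1 j F (- j # replicate k 1) =
    t_form n 1 j (\<lambda>w. F (- j # w)) (replicate k 1) - qd * F (- 1 # replicate k 1)"
proof -
  have one: "1 \<in> idx n" using assms(1) by (simp add: idx_def)
  let ?w = "replicate k (1 :: int)"
  have "t_form n 1 j F (- j # ?w) =
      (\<Sum>m\<in>idx n. (if m = 1 then t_form n 1 j (\<lambda>w. F (- j # w)) ?w else 0)
      + (if m = j then - (qd * F (- 1 # ?w)) else 0))"
    unfolding t_form_Cons[OF one assms(2), of "- j", unfolded idx_uminus, OF assms(2)]
  proof (rule sum.cong[OF refl])
    fix m assume m: "m \<in> idx n"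
    consider "m = 1" | "m = - 1" | "m = j" | "\<bar>1\<bar> < \<bar>m\<bar>" "m \<noteq> j"
      using idx_nonzero[OF m] by linarith
    then show "sgm 1 m j (par (- j)) * vec_form 1 m (- j) (\<lambda>c. t_form n m j (\<lambda>v. F (c # v)) ?w) =
        (if m = 1 then t_form n 1 j (\<lambda>w. F (- j # w)) ?w else 0)
        + (if m = j then - (qd * F (- 1 # ?w)) else 0)"
    proof cases
      case 1
      then show ?thesis using assms(3) by (simp add: vec_form_same sgm_def par_def dq_def)
    next
      case 2
      then show ?thesis using assms(3) vec_form_opp[of 1 "- j"] by simp
    next
      case 3
      then have "\<bar>1\<bar> < \<bar>j\<bar>" using assms(3) by simp
      from vec_form_less[OF this] show ?thesis
        using 3 assms t_form_ones_neq[of j n j] by (simp add: sgm_right par_def left_diff_distrib)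
    next
      case 4
      then have "m \<noteq> 1" by auto
      then show ?thesis
        using 4 assms(3) by (simp add: vec_form_less)
    qed
  qed
  then show ?thesis using one assms(2) by (simp add: sum.distrib)
qed

section \<open>The images of the top word modulo the submodule\<close>

text \<open>In closed form \<open>(q ^ (2 * k) - 1) / q\<close>.\<close>

fun ones_coeff :: "nat \<Rightarrow> Cq" where
  "ones_coeff 0 = 0"
| "ones_coeff (Suc k) = q\<^sup>2 * ones_coeff k + qd"

text \<open>The analogue for \<open>j = - 1\<close>, equal to
  \<open>q ^ (k - 1) * ones_coeff k\<close>.\<close>

fun ones_coeff_opp :: "nat \<Rightarrow> Cq" where
  "ones_coeff_opp 0 = 0"
| "ones_coeff_opp (Suc k) = q ^ 3 * ones_coeff_opp k + qd * q ^ k"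

text \<open>A letter \<open>j\<close> produced further right is moved to the front. Each letter 1
  that it passes costs one \<open>q\<close> from the skew relation, besides the eigenvalue
  \<open>q\<close> of \<open>t\<^sub>1\<^sub>1\<close> on that letter.\<close>

lemma t_form_one_qs_funs:
  assumes "F \<in> qs_funs n" "n \<ge> 1" "j \<in> idx n" "\<bar>j\<bar> > 1"
  shows "t_form n 1 j F (replicate (Suc k) 1) = ones_coeff (Suc k) * F (j # replicate k 1)"
  using assms(1)
proof (induction k arbitrary: F)
  case 0
  have "j \<noteq> 1" "j \<noteq> - 1" using assms(4) by auto
  then show ?case using t_form_one_ones_Suc[OF assms(2,3), of F 0] by simp
next
  case (Suc k)
  have one: "1 \<in> idx n" using assms(2) by (simp add: idx_def)
  have j: "j \<noteq> 1" "j \<noteq> - 1" using assms(4) by auto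
  have "(\<lambda>a b. F ([] @ a # b # replicate k 1)) \<in> qs_forms n"
    by (rule qs_funsD[OF Suc.prems]) (use set_replicate_one[OF assms(2)] in auto)
  from qs_forms_swap[OF this one assms(3)] assms(4)
  have "F (j # 1 # replicate k 1) = inverse q * F (1 # j # replicate k 1)"
    by (simp add: par_def)
  then have sw: "F (1 # j # replicate k 1) = q * F (j # 1 # replicate k 1)" by simp
  show ?case
    unfolding t_form_one_ones_Suc[OF assms(2,3) j(1), of F "Suc k"]
      Suc.IH[OF qs_funs_Cons[OF Suc.prems one]] sw
    using j by (simp add: algebra_simps power2_eq_square)
qed

text \<open>Moving \<open>- 1\<close> past 1 uses the potential instead: since
  \<open>r 0 = 0\<close>, the values at \<open>(1, - 1)\<close> and \<open>(- 1, 1)\<close> differ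
  by the factor \<open>q\<^sup>2\<close>.\<close>

lemma t_form_one_minus_one_qs_funs:
  assumes "F \<in> qs_funs n" "n \<ge> 1"
  shows "t_form n 1 (- 1) F (replicate (Suc k) 1) =
      ones_coeff_opp (Suc k) * F (- 1 # replicate k 1)"
  using assms(1)
proof (induction k arbitrary: F)
  have one: "1 \<in> idx n" "- 1 \<in> idx n" using assms(2) by (simp_all add: idx_def)
  {
    case 0
    then show ?case using t_form_one_ones_Suc[OF assms(2) one(2), of F 0] by simp
  next
    case (Suc k)
    have "(\<lambda>a b. F ([] @ a # b # replicate k 1)) \<in> qs_forms n"
      by (rule qs_funsD[OF Suc.prems]) (use set_replicate_one[OF assms(2)] in auto)
    then obtain r where "r 0 = 0"
      "\<And>s. 1 \<le> s \<Longrightarrow> s \<le> int n \<Longrightarrow> F (s # - s # replicate k 1) = r (s - 1) - q\<^sup>2 * r s"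
      "\<And>s. 1 \<le> s \<Longrightarrow> s \<le> int n \<Longrightarrow> F (- s # s # replicate k 1) = q\<^sup>2 * r (s - 1) - r s"
      by (rule qs_forms_potential) simp
    from this(1) this(2,3)[of 1] assms(2)
    have sw: "F (1 # - 1 # replicate k 1) = q\<^sup>2 * F (- 1 # 1 # replicate k 1)" by simp
    have "t_form n 1 (- 1) F (replicate (Suc (Suc k)) 1) =
        q * t_form n 1 (- 1) (\<lambda>w. F (1 # w)) (replicate (Suc k) 1)
        + qd * q ^ Suc k * F (- 1 # replicate (Suc k) 1)"
      using t_form_one_ones_Suc[OF assms(2) one(2), of F "Suc k"] by simp
    also have "\<dots> = q * (ones_coeff_opp (Suc k) * F (1 # - 1 # replicate k 1))
        + qd * q ^ Suc k * F (- 1 # replicate (Suc k) 1)"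
      by (simp only: Suc.IH[OF qs_funs_Cons[OF Suc.prems one(1)]])
    also have "\<dots> = ones_coeff_opp (Suc (Suc k)) * F (- 1 # replicate (Suc k) 1)"
      unfolding sw by (simp add: algebra_simps power2_eq_square power3_eq_cube)
    finally show ?case .
  }
qed

text \<open>The weights make \<open>q\<^sup>2 * r (s - 1) - r s\<close> telescope, leaving only the
  boundary values \<open>r 0\<close> and \<open>r n\<close>.\<close>

lemma qs_funs_cycle_sum:
  assumes "F \<in> qs_funs n" "set w \<subseteq> idx n"
  shows "(\<Sum>j=1..n. inverse q ^ (2 * j) * F (- int j # int j # w)) = 0"
proof -
  have "(\<lambda>a b. F ([] @ a # b # w)) \<in> qs_forms n"
    by (rule qs_funsD[OF assms(1)]) (use assms(2) in auto)
  then obtain r where r: "r 0 = 0" "r (int n) = 0"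
    "\<And>s. 1 \<le> s \<Longrightarrow> s \<le> int n \<Longrightarrow> F (- s # s # w) = q\<^sup>2 * r (s - 1) - r s"
    by (rule qs_forms_potential) simp
  have "(\<Sum>j=1..m. inverse q ^ (2 * j) * F (- int j # int j # w)) =
      - (inverse q ^ (2 * m) * r (int m))"
    if "m \<le> n" for m
    using that
  proof (induction m)
    case 0
    then show ?case by (simp add: r)
  next
    case (Suc m)
    have "F (- int (Suc m) # int (Suc m) # w) = q\<^sup>2 * r (int m) - r (int (Suc m))"
      using r(3)[of "int (Suc m)"] Suc.prems by simp
    moreover have "inverse q ^ (2 * Suc m) * (q\<^sup>2 * x) = inverse q ^ (2 * m) * x" for x
    proof -
      have "inverse q ^ (2 * Suc m) = inverse q ^ (2 * m) * inverse (q\<^sup>2)"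
        by (simp add: power2_eq_square)
      moreover have "inverse (q\<^sup>2) * (q\<^sup>2 * x) = x"
        by (simp flip: mult.assoc)
      ultimately show ?thesis by (simp only: mult.assoc)
    qed
    ultimately show ?case
      using Suc by (simp add: right_diff_distrib del: mult_Suc_right of_nat_Suc)
  qed
  from this[of n] r(2) show ?thesis by simp
qed

section \<open>Coefficients separating the images of the top word, and the conclusion\<close>

abbreviation t_one :: "nat \<Rightarrow> int \<Rightarrow> (int list \<Rightarrow>\<^sub>0 Cq) \<Rightarrow> (int list \<Rightarrow>\<^sub>0 Cq)" where
  "t_one n j \<equiv> lin_ext (t_word n 1 j)"

lemma t_form_zero: "t_form n i j (\<lambda>w. 0) w = 0"
  by (simp add: t_form_def)

lemma lookup_lower:
  assumes "n \<ge> 1"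
  shows "Poly_Mapping.lookup (t_one n (- 1) (Poly_Mapping.single (replicate (Suc k) 1) 1))
    (- 1 # replicate k 1) = qd * q ^ k"
proof -
  have one: "- 1 \<in> idx n" using assms by (simp add: idx_def)
  show ?thesis
    unfolding lookup_eq_pairing pairing_t_word pairing_single
    using t_form_one_ones_Suc[OF assms one, of "\<lambda>w. of_bool (w = - 1 # replicate k 1)" k]
    by (simp add: t_form_zero)
qed

lemma lookup_lower_cycle:
  assumes "n \<ge> 2"
  shows "Poly_Mapping.lookup (t_one n (- 1) (Poly_Mapping.single (replicate (Suc k) 1) 1))
    (- int n # w) = 0"
proof -
  have one: "n \<ge> 1" "- 1 \<in> idx n" using assms by (simp_all add: idx_def)
  show ?thesis
    unfolding lookup_eq_pairing pairing_t_word pairing_single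
    using t_form_one_ones_Suc[OF one, of "\<lambda>u. of_bool (u = - int n # w)" k] assms
    by (simp add: t_form_zero)
qed

text \<open>The word arises only if the inner operator turns the first letter into
  \<open>- j\<close>, which the outer one keeps while turning the next letter into \<open>j\<close>;
  this forces \<open>j = n\<close>.\<close>

lemma lookup_raise_lower:
  assumes "2 \<le> j" "j \<le> n"
  shows "Poly_Mapping.lookup (t_one n (int j) (t_one n (- int j) (Poly_Mapping.single (replicate
      (Suc (Suc k)) 1) 1)))
    (- int n # int n # replicate k 1) = of_bool (j = n) * qd\<^sup>2"
proof -
  let ?w = "- int n # int n # replicate k 1"
  let ?H = "\<lambda>u. of_bool (u = ?w) :: Cq"
  \<comment> \<open>Transposition reverses the order: the outer operator is absorbed into the
    functional first.\<close>
  let ?G = "t_form n 1 (int j) ?H"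
  have n: "n \<ge> 1" "j \<ge> 1" and idx: "1 \<in> idx n" "int j \<in> idx n" "- int j \<in> idx n"
    using assms by (auto simp: idx_def)
  \<comment> \<open>Turning a first letter 1 into \<open>- n\<close> would leave
    \<open>t\<^sub>-\<^sub>n\<^sub>,\<^sub>j\<close> acting on the rest, and this is zero: by
    triangularity for \<open>j < n\<close> and by \<open>t_form_opp_neg\<close> for
    \<open>j = n\<close>.\<close>
  have G1: "?G (1 # w) = 0" if w: "set w \<subseteq> idx n" for w
  proof -
    have "vec_form 1 m 1 (\<lambda>c. t_form n m (int j) (\<lambda>v. ?H (c # v)) w) = 0" if m: "m \<in> idx n" for m
    proof -
      have "t_form n m (int j) (\<lambda>v. ?H (m # v)) w = 0"
      proof (cases "m = - int n")
        case True
        show ?thesis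
        proof (cases "j = n")
          case True
          then show ?thesis
            using t_form_opp_neg[OF m _ w, of "\<lambda>v. ?H (m # v)"] \<open>m = - int n\<close> n by simp
        next
          case False
          then show ?thesis
            using t_form_gt[OF m idx(2) _ w, of "\<lambda>v. ?H (m # v)"] \<open>m = - int n\<close> assms by simp
        qed
      qed (simp add: t_form_zero)
      moreover have "t_form n 1 (int j) (\<lambda>v. ?H (1 # v)) w = 0" by (simp add: t_form_zero)
      ultimately show ?thesis unfolding vec_form_one[OF m] by simp
    qed
    then show ?thesis by (simp add: t_form_Cons idx)
  qed
  have "t_form n 1 (- int j) ?G (replicate (Suc (Suc k)) 1) =
      q * t_form n 1 (- int j) (\<lambda>u. ?G (1 # u)) (replicate (Suc k) 1) + qd *
          ?G (- int j # replicate (Suc k) 1)"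
    using t_form_one_ones_Suc[OF n(1) idx(3), of ?G "Suc k"] assms by simp
  also have "t_form n 1 (- int j) (\<lambda>u. ?G (1 # u)) (replicate (Suc k) 1) = 0"
    using t_form_cong[OF idx(1,3), of "replicate (Suc k) 1" "\<lambda>u. ?G (1 # u)" "\<lambda>u. 0"] G1
    by (simp add: t_form_zero)
  also have "?G (- int j # replicate (Suc k) 1) =
      t_form n 1 (int j) (\<lambda>u. ?H (- int j # u)) (replicate (Suc k) 1) - qd *
          ?H (- 1 # replicate (Suc k) 1)"
    using assms by (intro t_form_one_opp n idx) simp
  also have "?H (- 1 # replicate (Suc k) 1) = 0" using assms by simp
  also have "t_form n 1 (int j) (\<lambda>u. ?H (- int j # u)) (replicate (Suc k) 1) = of_bool (j = n) * qd"
  proof (cases "j = n")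
    case True
    show ?thesis
      using t_form_one_ones_Suc[OF n(1) idx(2), of "\<lambda>u. ?H (- int j # u)" k] assms True
      by (simp add: t_form_zero)
  qed (simp add: t_form_zero)
  finally show ?thesis
    unfolding lookup_eq_pairing pairing_t_word pairing_single by (simp add: power2_eq_square)
qed

theorem theorem5p14:
  fixes n k :: nat
  assumes "n \<ge> 1" and "k \<ge> 2"
  shows "\<not> completely_reducible_Vk n k"
proof (rule not_completely_reducible_VkI[OF assms(1) submodule_qs_kernel])
  show "Poly_Mapping.lookup v (replicate k 1) = 0" if "v \<in> qs_kernel n k" for v
    using that delta_qs_funs[of k n] unfolding lookup_eq_pairing qs_kernel_def by simp
next
  obtain l where k: "k = Suc (Suc l)" using assms(2) by (metis Suc_le_D numeral_2_eq_2 Suc_le_mono)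
  let ?x = "Poly_Mapping.single (replicate k (1 :: int)) (1 :: Cq)"
  let ?u = "- 1 # 1 # replicate l (1 :: int)"
  define y where "y = t_one n (- 1) ?x"
  \<comment> \<open>The weights are those of \<open>qs_funs_cycle_sum\<close>, whose remaining term
    \<open>j = 1\<close> belongs to the word \<open>?u\<close>.\<close>
  define z where "z = (\<Sum>j=2..n. inverse q ^ (2 * j) \<cdot> t_one n (int j) (t_one n (- int j) ?x))"
  \<comment> \<open>The two summands come from the two terms of \<open>t_form_one_opp\<close>, the
    first one after applying the cycle relation.\<close>
  define \<kappa> where "\<kappa> =
      - ones_coeff k * (ones_coeff (Suc l) * (inverse q)\<^sup>2 + qd * (\<Sum>j=2..n. inverse q ^ (2 * j)))"
  fix N assume N: "submodule_Vk n k N" "?x \<in> N"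
  then have sub: "scl.subspace N" and tensor: "N \<subseteq> tensor_power n k" by (simp_all add:
      submodule_Vk_def)
  have idx: "1 \<in> idx n" "int j \<in> idx n" "- int j \<in> idx n" if "1 \<le> j" "j \<le> n" for j
    using that by (auto simp: idx_def)
  have T: "t_one n i v \<in> N" if "i \<in> idx n" "v \<in> N" for i v
    using submodule_Vk_T[OF N(1) _ that(1) _ that(2), of 1] that(1) assms(1) by (simp add: idx_def)
  have yN: "y \<in> N" unfolding y_def using assms(1) N(2) by (intro T) (simp_all add: idx_def)
  have zN: "z \<in> N" unfolding z_def
    by (intro scl.subspace_sum[OF sub] scl.subspace_scale[OF sub] T N(2) idx) auto
  have y: "pairing F y = ones_coeff_opp k * F ?u" if "F \<in> qs_funs n" for F
    unfolding y_def pairing_t_word pairing_single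
    using t_form_one_minus_one_qs_funs[OF that assms(1), of "Suc l"] by (simp add: k)
  have cycle: "(\<Sum>j=2..n. inverse q ^ (2 * j) * F (- int j # int j # replicate l 1)) =
      - (inverse q)\<^sup>2 * F ?u"
    if "F \<in> qs_funs n" for F
  proof -
    have "{1..n} = insert 1 {2..n}" using assms(1) by auto
    then show ?thesis
      using qs_funs_cycle_sum[OF that set_replicate_one[OF assms(1)], of l] by (simp add:
          eq_neg_iff_add_eq_0 add.commute power2_eq_square)
  qed
  have z: "pairing F z = \<kappa> * F ?u" if F: "F \<in> qs_funs n" for F
  proof -
    have "pairing F (t_one n (int j) (t_one n (- int j) ?x)) =
        ones_coeff k * (ones_coeff (Suc l) * F (- int j # int j # replicate l 1) - qd * F ?u)"
      if j: "j \<in> {2..n}" for j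
    proof -
      have jn: "1 \<le> j" "j \<le> n" using j by auto
      note idx = idx[OF jn]
      have "pairing F (t_one n (int j) (t_one n (- int j) ?x)) =
          t_form n 1 (- int j) (t_form n 1 (int j) F) (replicate k 1)"
        unfolding pairing_t_word pairing_single by simp
      also have "\<dots> = ones_coeff k * t_form n 1 (int j) F (- int j # replicate (Suc l) 1)"
        unfolding k using j by (intro t_form_one_qs_funs t_form_qs_funs F idx assms(1)) auto
      also have "t_form n 1 (int j) F (- int j # replicate (Suc l) 1) =
          t_form n 1 (int j) (\<lambda>w. F (- int j # w)) (replicate (Suc l) 1) - qd *
              F (- 1 # replicate (Suc l) 1)"
        using j by (intro t_form_one_opp idx assms(1)) auto
      also have "t_form n 1 (int j) (\<lambda>w. F (- int j # w)) (replicate (Suc l) 1) =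
          ones_coeff (Suc l) * F (- int j # int j # replicate l 1)"
        using j by (intro t_form_one_qs_funs qs_funs_Cons F idx assms(1)) auto
      finally show ?thesis by simp
    qed
    then have "pairing F z = (\<Sum>j=2..n. inverse q ^ (2 * j) *
        (ones_coeff k * (ones_coeff (Suc l) * F (- int j # int j # replicate l 1) - qd * F ?u)))"
      unfolding z_def pairing_sum pairing_scl by (intro sum.cong) auto
    also have "\<dots> = ones_coeff k * (ones_coeff (Suc l) *
        (\<Sum>j=2..n. inverse q ^ (2 * j) * F (- int j # int j # replicate l 1))
        - qd * F ?u * (\<Sum>j=2..n. inverse q ^ (2 * j)))"
      by (simp only: sum_distrib_left sum_subtractf[symmetric] right_diff_distrib mult_ac)
    also have "\<dots> = \<kappa> * F ?u"
      unfolding cycle[OF F] \<kappa>_def by (simp add: algebra_simps del: ones_coeff.simps)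
    finally show ?thesis .
  qed
  have kernel: "v \<in> N \<inter> qs_kernel n k" if "v \<in> N" "\<And>F. F \<in> qs_funs n \<Longrightarrow> pairing F v = 0" for v
    using that tensor by (auto simp: qs_kernel_def)
  show "N \<inter> qs_kernel n k \<noteq> {0}"
  proof (cases "n = 1 \<or> ones_coeff_opp k = 0")
    \<comment> \<open>For \<open>n = 1\<close> the sum in \<open>cycle\<close> is empty, so it says
      that \<open>F ?u\<close> is zero; in both cases \<open>y\<close> itself lies in the
      kernel.\<close>
    case True
    have "pairing F y = 0" if "F \<in> qs_funs n" for F
      using True y[OF that] cycle[OF that] by auto
    then have "y \<in> N \<inter> qs_kernel n k" by (intro kernel yN)
    moreover have "y \<noteq> 0"
      using lookup_lower[OF assms(1), of "Suc l"] qd_nonzero by (auto simp: y_def k)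
    ultimately show ?thesis by blast
  next
    case False
    \<comment> \<open>On \<open>qs_funs n\<close> both \<open>y\<close> and \<open>z\<close> act as
      multiples of evaluation at \<open>?u\<close>; this combination cancels them.\<close>
    let ?v = "z - (\<kappa> / ones_coeff_opp k) \<cdot> y"
    have "?v \<in> N" by (intro scl.subspace_diff[OF sub] scl.subspace_scale[OF sub] yN zN)
    moreover have "pairing F ?v = 0" if "F \<in> qs_funs n" for F
      unfolding pairing_minus pairing_scl y[OF that] z[OF that] using False by simp
    ultimately have "?v \<in> N \<inter> qs_kernel n k" by (rule kernel)
    moreover have "?v \<noteq> 0"
    proof -
      \<comment> \<open>This word does not occur in \<open>y\<close>, and in \<open>z\<close> it
        comes from \<open>j = n\<close> alone, so nothing can cancel it.\<close>
      let ?w = "- int n # int n # replicate l 1"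
      have n: "n \<ge> 2" using False assms(1) by simp
      have "Poly_Mapping.lookup z ?w = (\<Sum>j=2..n. if j = n then inverse q ^ (2 * n) * qd\<^sup>2 else 0)"
        unfolding z_def lookup_sum lookup_scl
      proof (rule sum.cong[OF refl])
        fix j assume "j \<in> {2..n}"
        then show "inverse q ^ (2 * j) *
            Poly_Mapping.lookup (t_one n (int j) (t_one n (- int j) ?x)) ?w =
            (if j = n then inverse q ^ (2 * n) * qd\<^sup>2 else 0)"
          using lookup_raise_lower[of j n l] unfolding k by auto
      qed
      moreover have "Poly_Mapping.lookup y ?w = 0"
        unfolding y_def k by (rule lookup_lower_cycle[OF n])
      ultimately have "Poly_Mapping.lookup ?v ?w = inverse q ^ (2 * n) * qd\<^sup>2"
        using n by (simp add: lookup_minus)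
      then show ?thesis using qd_nonzero by auto
    qed
    ultimately show ?thesis by blast
  qed
qed

end
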